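(* Let $\equiv$ be an essential semilattice congruence on the left weak order of a Coxeter group $W$. The Coxeter stack-sorting operator $\mathbf S_\equiv:W\to W$ is compulsive. If $W$ is finite and irreducible and has Coxeter number $h$, then $$\max_{w\in W}\left\lvert O_{\mathbf S_\equiv}(w)\right\rvert\leq h,$$ where $O_{\mathbf S_\equiv}(w)=\{w,\mathbf S_\equiv(w),\mathbf S_\equiv^2(w),\ldots\}$ is the forward orbit of $w$.
   Context: Let $(W,S)$ be a Coxeter system with length function $\ell$ and identity $e$. The left weak order is $x\leq_L y\iff\ell(yx^{-1})=\ell(y)-\ell(x)$, and the right weak order is $x\leq_R y\iff\ell(x^{-1}y)=\ell(y)-\ell(x)$. The right descent set is $D_R(w)=\{s\in S:\ell(ws)<\ell(w)\}$. The left weak order is a locally finite meet-semilattice with minimum $e$ (Björner). A semilattice congruence on it is an equivalence relation $\equiv$ such that $x_1\equiv x_2$ and $y_1\equiv y_2$ imply $x_1\wedge y_1\equiv x_2\wedge y_2$. It is essential if $\{e\}$ is a congruence class. Every class has a unique minimal element; $\pi_\downarrow^\equiv(w)$ denotes the minimal element of the class of $w$. The Coxeter stack-sorting operator is $\mathbf S_\equiv(w)=w\,(\pi_\downarrow^\equiv(w))^{-1}$. A map $f:W\to W$ is compulsive if $f(w)\leq_R w$ and $f(w)\leq_R ws$ for all $w\in W$ and all $s\in D_R(w)$. The Coxeter number of a finite Coxeter group is the order of a Coxeter element (a product of all simple generators, each used once, in some order). $W$ is irreducible if its Coxeter diagram is connected. *)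

theory Defs
  imports
    "HOL-Algebra.Multiplicative_Group"
    "HOL-Algebra.Generated_Groups"
    "HOL-Algebra.Lattice"
    "HOL-Library.Extended_Nat"
    "Graph_Theory.Digraph_Component"
begin

section \<open>Coxeter systems\<close>

definition word_prod :: "('a, 'b) monoid_scheme \<Rightarrow> 'a list \<Rightarrow> 'a" where
  "word_prod W u = foldr (\<lambda>s g. s \<otimes>\<^bsub>W\<^esub> g) u \<one>\<^bsub>W\<^esub>"

definition coxeter_matrix :: "'a set \<Rightarrow> ('a \<Rightarrow> 'a \<Rightarrow> enat) \<Rightarrow> bool" where
  "coxeter_matrix S m \<longleftrightarrow>
     (\<forall>s\<in>S. m s s = 1) \<and>
     (\<forall>s\<in>S. \<forall>t\<in>S. m s t = m t s) \<and>
     (\<forall>s\<in>S. \<forall>t\<in>S. s \<noteq> t \<longrightarrow> 2 \<le> m s t)"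

text \<open>
  Deletion of one factor \<open>(s t)\<^sup>k\<close> with \<open>k = m(s,t)\<close> finite; \<open>m(s,t) = \<infinity>\<close> gives no relation.
\<close>

inductive delete_relator :: "'a set \<Rightarrow> ('a \<Rightarrow> 'a \<Rightarrow> enat) \<Rightarrow> 'a list \<Rightarrow> 'a list \<Rightarrow> bool"
  for S :: "'a set" and m :: "'a \<Rightarrow> 'a \<Rightarrow> enat" where
  "\<lbrakk>u \<in> lists S; v \<in> lists S; s \<in> S; t \<in> S; m s t = enat k\<rbrakk> \<Longrightarrow>
     delete_relator S m (u @ concat (replicate k [s, t]) @ v) (u @ v)"

text \<open>
  \<open>W\<close> is the group presented by the generators \<open>S\<close> and the relations \<open>(s t)\<^sup>m\<^sup>(\<^sup>s\<^sup>,\<^sup>t\<^sup>) = 1\<close>.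
  No formal inverses of letters are needed, because the relation for \<open>m(s,s) = 1\<close> is \<open>s s = 1\<close>:
  \<open>W\<close> is the quotient of the free monoid \<open>lists S\<close> by the equivalence generated by insertion and
  deletion of relators.
\<close>

locale coxeter_system = group W
  for W :: "('a, 'b) monoid_scheme" (structure) +
  fixes S :: "'a set" and m :: "'a \<Rightarrow> 'a \<Rightarrow> enat"
  assumes gens_subset: "S \<subseteq> carrier W"
    and matrix: "coxeter_matrix S m"
    and generates: "generate W S = carrier W"
    and presentation: "\<lbrakk>u \<in> lists S; v \<in> lists S\<rbrakk> \<Longrightarrow>
      word_prod W u = word_prod W v \<longleftrightarrow> equivclp (delete_relator S m) u v"

definition coxeter_length :: "('a, 'b) monoid_scheme \<Rightarrow> 'a set \<Rightarrow> 'a \<Rightarrow> nat" where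
  "coxeter_length W S w = (LEAST n. \<exists>u\<in>lists S. length u = n \<and> word_prod W u = w)"

definition right_descents :: "('a, 'b) monoid_scheme \<Rightarrow> 'a set \<Rightarrow> 'a \<Rightarrow> 'a set" where
  "right_descents W S w =
     {s \<in> S. coxeter_length W S (w \<otimes>\<^bsub>W\<^esub> s) < coxeter_length W S w}"

definition coxeter_diagram :: "'a set \<Rightarrow> ('a \<Rightarrow> 'a \<Rightarrow> enat) \<Rightarrow> 'a pair_pre_digraph" where
  "coxeter_diagram S m =
     \<lparr>pverts = S, parcs = {(s, t). s \<in> S \<and> t \<in> S \<and> s \<noteq> t \<and> 3 \<le> m s t}\<rparr>"

definition irreducible_coxeter :: "'a set \<Rightarrow> ('a \<Rightarrow> 'a \<Rightarrow> enat) \<Rightarrow> bool" where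
  "irreducible_coxeter S m \<longleftrightarrow> connected (with_proj (coxeter_diagram S m))"

definition coxeter_element :: "('a, 'b) monoid_scheme \<Rightarrow> 'a set \<Rightarrow> 'a \<Rightarrow> bool" where
  "coxeter_element W S c \<longleftrightarrow> (\<exists>u. distinct u \<and> set u = S \<and> c = word_prod W u)"

text \<open>
  A predicate rather than a function, so that the independence of the order of \<open>c\<close> from the choice
  of \<open>c\<close> is not built in.
\<close>

definition has_coxeter_number :: "('a, 'b) monoid_scheme \<Rightarrow> 'a set \<Rightarrow> nat \<Rightarrow> bool" where
  "has_coxeter_number W S h \<longleftrightarrow> (\<exists>c. coxeter_element W S c \<and> group.ord W c = h)"


section \<open>Weak orders\<close>

definition left_weak_le :: "('a, 'b) monoid_scheme \<Rightarrow> 'a set \<Rightarrow> 'a \<Rightarrow> 'a \<Rightarrow> bool" where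
  "left_weak_le W S x y \<longleftrightarrow>
     int (coxeter_length W S (y \<otimes>\<^bsub>W\<^esub> inv\<^bsub>W\<^esub> x))
       = int (coxeter_length W S y) - int (coxeter_length W S x)"

definition right_weak_le :: "('a, 'b) monoid_scheme \<Rightarrow> 'a set \<Rightarrow> 'a \<Rightarrow> 'a \<Rightarrow> bool" where
  "right_weak_le W S x y \<longleftrightarrow>
     int (coxeter_length W S (inv\<^bsub>W\<^esub> x \<otimes>\<^bsub>W\<^esub> y))
       = int (coxeter_length W S y) - int (coxeter_length W S x)"

definition left_weak_order :: "('a, 'b) monoid_scheme \<Rightarrow> 'a set \<Rightarrow> 'a gorder" where
  "left_weak_order W S = \<lparr>carrier = carrier W, eq = (=), le = left_weak_le W S\<rparr>"


section \<open>Semilattice congruences and Coxeter stack-sorting\<close>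

definition semilattice_congruence :: "('a, 'b) monoid_scheme \<Rightarrow> 'a set \<Rightarrow> 'a rel \<Rightarrow> bool" where
  "semilattice_congruence W S r \<longleftrightarrow>
     equiv (carrier W) r \<and>
     (\<forall>x1 x2 y1 y2. (x1, x2) \<in> r \<longrightarrow> (y1, y2) \<in> r \<longrightarrow>
        (x1 \<sqinter>\<^bsub>left_weak_order W S\<^esub> y1, x2 \<sqinter>\<^bsub>left_weak_order W S\<^esub> y2) \<in> r)"

definition essential :: "('a, 'b) monoid_scheme \<Rightarrow> 'a rel \<Rightarrow> bool" where
  "essential W r \<longleftrightarrow> {\<one>\<^bsub>W\<^esub>} \<in> carrier W // r"

definition proj_down :: "('a, 'b) monoid_scheme \<Rightarrow> 'a set \<Rightarrow> 'a rel \<Rightarrow> 'a \<Rightarrow> 'a" where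
  "proj_down W S r w =
     (THE v. v \<in> r `` {w} \<and> (\<forall>u \<in> r `` {w}. left_weak_le W S u v \<longrightarrow> u = v))"

definition stack_sort :: "('a, 'b) monoid_scheme \<Rightarrow> 'a set \<Rightarrow> 'a rel \<Rightarrow> 'a \<Rightarrow> 'a" where
  "stack_sort W S r w = w \<otimes>\<^bsub>W\<^esub> inv\<^bsub>W\<^esub> (proj_down W S r w)"

definition compulsive :: "('a, 'b) monoid_scheme \<Rightarrow> 'a set \<Rightarrow> ('a \<Rightarrow> 'a) \<Rightarrow> bool" where
  "compulsive W S f \<longleftrightarrow>
     f \<in> carrier W \<rightarrow> carrier W \<and>
     (\<forall>w\<in>carrier W. right_weak_le W S (f w) w \<and>
        (\<forall>s\<in>right_descents W S w. right_weak_le W S (f w) (w \<otimes>\<^bsub>W\<^esub> s)))"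

definition forward_orbit :: "('a \<Rightarrow> 'a) \<Rightarrow> 'a \<Rightarrow> 'a set" where
  "forward_orbit f w = {(f ^^ k) w |k. True}"

end

theory Submission
  imports Defs "HOL-Library.Sublist" "HOL-Analysis.Function_Topology"
begin

text \<open>
  The minimal element \<open>p\<close> of the class of \<open>w\<close> has all right descents of \<open>w\<close>: for such a
  descent \<open>s\<close>, the meet of \<open>s\<close> and \<open>p\<close> is congruent to the meet of \<open>s\<close> and \<open>w\<close>, which is
  \<open>s\<close>, and since the class of the identity is trivial it must be \<open>s\<close> itself. Length counting turns
  this into compulsiveness.

  In the finite irreducible case the Coxeter diagram is a forest, hence bipartite with parts \<open>X\<close> and
  \<open>Y\<close>, and all Coxeter elements are conjugate. As in Steinberg's argument, the Perron vector of the
  diagram shows that the longest element is an alternating product of exactly \<open>h\<close> blocks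
  \<open>\<Prod>X\<close> and \<open>\<Prod>Y\<close>, starting with either one. If \<open>w\<close> is a product of a subword of such an
  alternating word, then a compulsive map sends it to a product of a subword of the word without its
  last block. Hence after \<open>h - 1\<close> steps every element lies both in the parabolic subgroup of \<open>X\<close> and
  in that of \<open>Y\<close>, so it is the identity.
\<close>

section \<open>Words, length and exchange\<close>

text \<open>Two invariants of words extract everything from the presentation: the parity with which
  each reflection occurs, which yields exchange, and the position reached in the numbers game, whose
  signs decide descents. A position is just a function on \<open>S\<close>, and every positive
  function can serve as a start; this freedom later allows the Perron vector itself to be played.
  Meets must be constructed for infinite \<open>W\<close> as well, since compulsiveness is claimed
  without finiteness.

  The bound is \<open>h\<close> rather than \<open>h + 1\<close> because the longest element has two
  alternating factorizations. One of them alone would need \<open>h\<close> steps to lose all its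
  blocks; with both, the two remainders of one block already meet trivially after
  \<open>h - 1\<close> steps. The number of blocks is identified with \<open>h\<close> without
  classification: it is an exponent that kills a Coxeter element, and a smaller order would turn a
  reduced alternating word into the identity.\<close>

context coxeter_system
begin

abbreviation ev :: "'a list \<Rightarrow> 'a" where "ev \<equiv> word_prod W"
abbreviation len :: "'a \<Rightarrow> nat" where "len \<equiv> coxeter_length W S"

lemma S_carrier [simp]: "s \<in> S \<Longrightarrow> s \<in> carrier W"
  using gens_subset by auto

declare in_lists_conv_set [simp del] in_listsD [rule del] in_listsI [rule del]

lemma rev_in_lists [simp]: "rev u \<in> lists A \<longleftrightarrow> u \<in> lists A"
  by (simp add: in_lists_conv_set)

lemma ev_Nil [simp]: "ev [] = \<one>"
  and ev_Cons [simp]: "ev (s # u) = s \<otimes> ev u"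
  by (simp_all add: word_prod_def)

lemma ev_closed [simp]: "u \<in> lists S \<Longrightarrow> ev u \<in> carrier W"
  by (induction u) auto

lemma ev_append [simp]: "u \<in> lists S \<Longrightarrow> v \<in> lists S \<Longrightarrow> ev (u @ v) = ev u \<otimes> ev v"
  by (induction u) (auto simp: m_assoc)

lemma m_self: "s \<in> S \<Longrightarrow> m s s = 1"
  and m_sym: "s \<in> S \<Longrightarrow> t \<in> S \<Longrightarrow> m s t = m t s"
  and m_ge_2: "s \<in> S \<Longrightarrow> t \<in> S \<Longrightarrow> s \<noteq> t \<Longrightarrow> 2 \<le> m s t"
  using matrix by (auto simp: coxeter_matrix_def)

lemma relator_lists: "s \<in> S \<Longrightarrow> t \<in> S \<Longrightarrow> concat (replicate k [s, t]) \<in> lists S"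
  by (induction k) auto

lemma ev_relator:
  assumes "s \<in> S" "t \<in> S" "m s t = enat k"
  shows "ev (concat (replicate k [s, t])) = \<one>"
proof -
  have "delete_relator S m ([] @ concat (replicate k [s, t]) @ []) ([] @ [])"
    by (rule delete_relator.intros) (use assms in auto)
  hence "equivclp (delete_relator S m) (concat (replicate k [s, t])) []"
    by (auto intro: r_into_equivclp)
  thus ?thesis using presentation[OF relator_lists[OF assms(1,2)], of "[]"] by simp
qed

lemma gen_square [simp]: "s \<in> S \<Longrightarrow> s \<otimes> s = \<one>"
  using ev_relator[of s s 1] by (simp add: m_self one_enat_def)

lemma gen_square' [simp]: "s \<in> S \<Longrightarrow> w \<in> carrier W \<Longrightarrow> s \<otimes> (s \<otimes> w) = w"
  by (simp flip: m_assoc)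

lemma gen_square_right [simp]: "s \<in> S \<Longrightarrow> w \<in> carrier W \<Longrightarrow> w \<otimes> s \<otimes> s = w"
  by (simp add: m_assoc)

lemma gen_inv [simp]: "s \<in> S \<Longrightarrow> inv s = s"
  by (rule inv_equality) auto

lemma ev_rev: "u \<in> lists S \<Longrightarrow> ev (rev u) = inv (ev u)"
  by (induction u) (auto simp: inv_mult_group)

lemma ex_word:
  assumes "w \<in> carrier W"
  shows "\<exists>u\<in>lists S. ev u = w"
proof -
  have "w \<in> generate W S" using assms generates by simp
  thus ?thesis
  proof induction
    case one
    show ?case by (intro bexI[of _ "[]"]) auto
  next
    case (incl h)
    thus ?case by (intro bexI[of _ "[h]"]) auto
  next
    case (inv h)
    thus ?case by (intro bexI[of _ "[h]"]) auto
  next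
    case (eng h1 h2)
    then obtain u v where "u \<in> lists S" "v \<in> lists S" "ev u = h1" "ev v = h2" by auto
    thus ?case by (intro bexI[of _ "u @ v"]) auto
  qed
qed

lemma ex_reduced_word:
  assumes "w \<in> carrier W"
  shows "\<exists>u\<in>lists S. length u = len w \<and> ev u = w"
proof -
  from ex_word[OF assms] have "\<exists>n. \<exists>u\<in>lists S. length u = n \<and> ev u = w" by auto
  from LeastI_ex[OF this] show ?thesis unfolding coxeter_length_def .
qed

lemma len_ev_le: "u \<in> lists S \<Longrightarrow> len (ev u) \<le> length u"
  unfolding coxeter_length_def by (rule Least_le) auto

lemma len_one [simp]: "len \<one> = 0"
  using len_ev_le[of "[]"] by simp

lemma len_eq_0: "w \<in> carrier W \<Longrightarrow> len w = 0 \<longleftrightarrow> w = \<one>"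
  using ex_reduced_word[of w] by auto

lemma len_mult:
  assumes "x \<in> carrier W" "y \<in> carrier W"
  shows "len (x \<otimes> y) \<le> len x + len y"
proof -
  obtain u v where "u \<in> lists S" "length u = len x" "ev u = x" "v \<in> lists S" "length v = len y" "ev v = y"
    using ex_reduced_word assms by metis
  thus ?thesis using len_ev_le[of "u @ v"] by simp
qed

lemma len_inv [simp]:
  assumes "x \<in> carrier W"
  shows "len (inv x) = len x"
proof -
  have *: "len (inv x) \<le> len x" if x: "x \<in> carrier W" for x
  proof -
    obtain u where "u \<in> lists S" "length u = len x" "ev u = x"
      using ex_reduced_word x by metis
    thus ?thesis using len_ev_le[of "rev u"] by (simp add: ev_rev)
  qed
  from *[of x] *[of "inv x"] assms show ?thesis by simp
qed

lemma len_gen: "s \<in> S \<Longrightarrow> len s \<le> 1"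
  using len_ev_le[of "[s]"] by simp

lemma len_mult_gen: "w \<in> carrier W \<Longrightarrow> s \<in> S \<Longrightarrow> len (w \<otimes> s) \<le> len w + 1"
  using len_mult[of w s] len_gen[of s] by simp

lemma len_mult_gen_ge: "w \<in> carrier W \<Longrightarrow> s \<in> S \<Longrightarrow> len w \<le> len (w \<otimes> s) + 1"
  using len_mult_gen[of "w \<otimes> s" s] by simp

section \<open>Reflection sequences and the exchange condition\<close>

definition conjg :: "'a \<Rightarrow> 'a \<Rightarrow> 'a" where
  "conjg g x = g \<otimes> x \<otimes> inv g"

lemma conjg_closed [simp]: "g \<in> carrier W \<Longrightarrow> x \<in> carrier W \<Longrightarrow> conjg g x \<in> carrier W"
  by (simp add: conjg_def)

lemma conjg_conj: "g \<in> carrier W \<Longrightarrow> h \<in> carrier W \<Longrightarrow> x \<in> carrier W \<Longrightarrow> conjg g (conjg h x) = conjg (g \<otimes> h) x"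
  by (simp add: conjg_def m_assoc inv_mult_group)

lemma conjg_one [simp]: "x \<in> carrier W \<Longrightarrow> conjg \<one> x = x"
  by (simp add: conjg_def)

lemma conjg_eq_iff:
  assumes "g \<in> carrier W" "x \<in> carrier W" "y \<in> carrier W"
  shows "conjg g x = y \<longleftrightarrow> x = conjg (inv g) y"
proof
  assume "conjg g x = y"
  hence "conjg (inv g) y = conjg (inv g) (conjg g x)" by simp
  thus "x = conjg (inv g) y" using assms by (simp add: conjg_conj)
next
  assume "x = conjg (inv g) y"
  thus "conjg g x = y" using assms by (simp add: conjg_conj)
qed

text \<open>The i-th entry is s_1 ... s_(i-1) s_i s_(i-1) ... s_1; multiplying by it on the left
  deletes the i-th letter. Repetitions are kept, because for nonreduced words the parity of the
  multiplicities is the invariant.\<close>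

fun refls :: "'a list \<Rightarrow> 'a list" where
  "refls [] = []"
| "refls (s # u) = s # map (conjg s) (refls u)"

lemma length_refls [simp]: "length (refls u) = length u"
  by (induction u) auto

lemma set_refls: "u \<in> lists S \<Longrightarrow> set (refls u) \<subseteq> carrier W"
  by (induction u) auto

lemma refls_append:
  "u \<in> lists S \<Longrightarrow> v \<in> lists S \<Longrightarrow> refls (u @ v) = refls u @ map (conjg (ev u)) (refls v)"
proof (induction u)
  case Nil
  then show ?case using set_refls[of v] by (auto intro!: map_idI[symmetric])
next
  case (Cons s u)
  then show ?case using set_refls[of v] by (auto simp: conjg_conj)
qed

lemma refls_nth:
  "u \<in> lists S \<Longrightarrow> i < length u \<Longrightarrow> refls u ! i \<otimes> ev u = ev (take i u @ drop (Suc i) u)"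
proof (induction u arbitrary: i)
  case Nil
  then show ?case by simp
next
  case (Cons s u)
  show ?case
  proof (cases i)
    case 0
    then show ?thesis using Cons by simp
  next
    case (Suc j)
    have j: "j < length u" using Cons.prems Suc by simp
    have c: "refls u ! j \<in> carrier W"
      using set_refls[of u] Cons.prems j by (auto simp: subset_iff)
    have "conjg s (refls u ! j) \<otimes> (s \<otimes> ev u) = s \<otimes> (refls u ! j \<otimes> ev u)"
      using Cons.prems c by (simp add: conjg_def m_assoc)
    thus ?thesis using Suc j Cons by simp
  qed
qed

lemma count_map_conj:
  assumes "g \<in> carrier W" "x \<in> carrier W" "set L \<subseteq> carrier W"
  shows "count_list (map (conjg g) L) x = count_list L (conjg (inv g) x)"
  using assms(3)
proof (induction L)
  case (Cons a L)
  have "conjg g a = x \<longleftrightarrow> a = conjg (inv g) x"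
    using assms Cons.prems by (intro conjg_eq_iff) auto
  with Cons show ?case by auto
qed simp

text \<open>The sequence of reflections of a relator \<open>(s t)\<^sup>k\<close> is periodic of period \<open>k\<close>, so each
  reflection occurs an even number of times.\<close>

lemma refls_relator:
  assumes "s \<in> S" "t \<in> S" "m s t = enat k"
  shows "\<exists>L. refls (concat (replicate k [s, t])) = L @ L"
proof -
  define c where "c = s \<otimes> t"
  have c: "c \<in> carrier W" using assms by (simp add: c_def)
  have evc: "ev (concat (replicate j [s, t])) = c [^] j" for j
  proof (induction j)
    case (Suc j)
    have "c [^] Suc j = s \<otimes> (t \<otimes> c [^] j)"
      unfolding nat_pow_Suc2[OF c] using assms(1,2) c by (simp add: c_def m_assoc)
    with Suc show ?case using assms(1,2) relator_lists[OF assms(1,2)] by simp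
  qed simp
  have inv_c: "inv c = t \<otimes> s" using assms by (simp add: c_def inv_mult_group)
  \<comment> \<open>Prepending \<open>[s, t]\<close> conjugates by \<open>c\<close>, which raises
    the exponent by 2 because conjugation by \<open>s\<close> inverts \<open>c\<close>.\<close>
  have conjg_c: "conjg c (c [^] i \<otimes> s) = c [^] (i + 2) \<otimes> s" for i :: nat
  proof -
    have "conjg c (c [^] i \<otimes> s) = c [^] Suc i \<otimes> s \<otimes> inv c"
      unfolding nat_pow_Suc2[OF c] using assms(1,2) c by (simp add: conjg_def m_assoc)
    also have "s \<otimes> inv c = c \<otimes> s" unfolding inv_c using assms(1,2) by (simp add: c_def m_assoc)
    hence "c [^] Suc i \<otimes> s \<otimes> inv c = c [^] Suc i \<otimes> c \<otimes> s"
      using assms(1,2) c by (simp add: m_assoc del: nat_pow_Suc)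
    also have "\<dots> = c [^] (i + 2) \<otimes> s" using c by (simp add: m_assoc)
    finally show ?thesis .
  qed
  have r: "refls (concat (replicate j [s, t])) = map (\<lambda>i. c [^] i \<otimes> s) [0..<2 * j]" for j
  proof (induction j)
    case (Suc j)
    have "refls (concat (replicate (Suc j) [s, t]))
        = refls [s, t] @ map (conjg (ev [s, t])) (refls (concat (replicate j [s, t])))"
      using refls_append[of "[s, t]" "concat (replicate j [s, t])"] assms(1,2)
        relator_lists[OF assms(1,2)] by simp
    also have "refls [s, t] = map (\<lambda>i. c [^] i \<otimes> s) [0..<2]"
      using assms(1,2) c by (simp add: conjg_def c_def numeral_2_eq_2)
    also have "ev [s, t] = c" using assms(1,2) by (simp add: c_def)
    also have "map (conjg c) (refls (concat (replicate j [s, t]))) = map (\<lambda>i. c [^] i \<otimes> s) (map (\<lambda>i. i + 2) [0..<2 * j])"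
      by (simp add: Suc.IH conjg_c)
    also have "map (\<lambda>i. c [^] i \<otimes> s) [0..<2] @ map (\<lambda>i. c [^] i \<otimes> s) (map (\<lambda>i. i + 2) [0..<2 * j])
      = map (\<lambda>i. c [^] i \<otimes> s) [0..<2 * Suc j]"
    proof -
      have "map (\<lambda>i. i + 2) [0..<2 * j] = [2..<2 * j + 2]"
        using map_add_upt[of 2 "2 * j"] by simp
      moreover have "[0..<2] @ [2..<2 * j + 2] = [0..<2 * Suc j]"
        using upt_add_eq_append[of 0 2 "2 * j"] by (simp add: add.commute)
      ultimately show ?thesis by (metis map_append)
    qed
    finally show ?case .
  qed simp
  have ck: "c [^] k = \<one>" using ev_relator[OF assms] evc by simp
  have "map (\<lambda>i. c [^] i \<otimes> s) [0..<2 * k] = map (\<lambda>i. c [^] i \<otimes> s) ([0..<k] @ map (\<lambda>i. i + k) [0..<k])"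
    using upt_add_eq_append[of 0 k k] map_add_upt[of k k] by (simp add: mult_2)
  also have "\<dots> = map (\<lambda>i. c [^] i \<otimes> s) [0..<k] @ map (\<lambda>i. c [^] i \<otimes> s) [0..<k]"
    using c assms(1) by (auto simp: ck simp flip: nat_pow_mult)
  finally show ?thesis using r by auto
qed

text \<open>Invariance under deleting one relator passes to the generated equivalence, which by the
  presentation is equality in \<open>W\<close>. It serves for the parity of reflections and for the
  numbers game.\<close>

lemma word_invariant:
  assumes "u \<in> lists S" "v \<in> lists S" "ev u = ev v"
    and "\<And>u v s t k. u \<in> lists S \<Longrightarrow> v \<in> lists S \<Longrightarrow> s \<in> S \<Longrightarrow> t \<in> S \<Longrightarrow> m s t = enat k \<Longrightarrow>
      f (u @ concat (replicate k [s, t]) @ v) = f (u @ v)"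
  shows "f u = f v"
proof -
  have d: "f x = f y" if "delete_relator S m x y" for x y
    using that by induction (rule assms(4))
  have "equivclp (delete_relator S m) u v" using presentation assms(1-3) by blast
  thus ?thesis by (induction rule: equivclp_induct) (auto dest: d)
qed

text \<open>A relator has value \<one>, so it does not conjugate the reflections of the letters
  after it, and its own sequence \<open>L @ L\<close> contributes each reflection an even number of
  times.\<close>

lemma refls_parity:
  assumes "u \<in> lists S" "v \<in> lists S" "ev u = ev v" "x \<in> carrier W"
  shows "even (count_list (refls u) x) \<longleftrightarrow> even (count_list (refls v) x)"
  using assms(1-3)
proof (rule word_invariant)
  fix u v s t k
  assume *: "u \<in> lists S" "v \<in> lists S" "s \<in> S" "t \<in> S" "m s t = enat k"
  let ?R = "concat (replicate k [s, t])"
  have R: "?R \<in> lists S" "ev ?R = \<one>" using * by (auto intro: relator_lists ev_relator)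
  obtain L where L: "refls ?R = L @ L" using refls_relator * by blast
  have "refls (u @ ?R @ v) = refls u @ map (conjg (ev u)) (L @ L @ refls v)"
    using * R set_refls[of v] by (simp add: refls_append L map_idI subset_iff)
  thus "even (count_list (refls (u @ ?R @ v)) x) = even (count_list (refls (u @ v)) x)"
    using * by (simp add: refls_append) blast
qed

lemma left_exchange_aux:
  assumes "u \<in> lists S" "x \<in> carrier W" "odd (count_list (refls u) x)"
  shows "\<exists>i<length u. x \<otimes> ev u = ev (take i u @ drop (Suc i) u)"
proof -
  have "x \<in> set (refls u)" using assms(3) count_notin by fastforce
  then obtain i where "i < length u" "refls u ! i = x" by (auto simp: in_set_conv_nth)
  thus ?thesis using refls_nth[OF assms(1)] by auto
qed

lemma length_delete_nth: "i < length u \<Longrightarrow> length (take i u @ drop (Suc i) u) = length u - 1"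
  by auto

lemma delete_nth_lists: "u \<in> lists A \<Longrightarrow> take i u @ drop (Suc i) u \<in> lists A"
  by (auto simp: in_lists_conv_set dest: in_set_takeD in_set_dropD)

text \<open>Odd multiplicity survives the passage to a reduced word, where a reflection that occurs
  deletes a letter.\<close>

lemma len_odd_refls:
  assumes "u \<in> lists S" "s \<in> carrier W" "odd (count_list (refls u) s)"
  shows "len (s \<otimes> ev u) < len (ev u)"
proof -
  obtain v where v: "v \<in> lists S" "length v = len (ev u)" "ev v = ev u"
    using ex_reduced_word assms(1) by (metis ev_closed)
  have "odd (count_list (refls v) s)" using refls_parity[of u v s] assms v by auto
  then obtain i where "i < length v" "s \<otimes> ev v = ev (take i v @ drop (Suc i) v)"
    using left_exchange_aux v assms by blast
  thus ?thesis
    using v len_ev_le[OF delete_nth_lists[OF v(1), of i]] length_delete_nth[of i v] by simp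
qed

text \<open>Conjugation by \<open>s\<close> fixes \<open>s\<close>, so prepending \<open>s\<close>
  toggles the parity of its multiplicity. If it were even for \<open>u\<close>, it would be odd for
  \<open>s # u\<close>, and \<open>ev u\<close> would be shorter than
  \<open>s \<otimes> ev u\<close>.\<close>

lemma left_odd_iff:
  assumes "u \<in> lists S" "s \<in> S"
  shows "odd (count_list (refls u) s) \<longleftrightarrow> len (s \<otimes> ev u) < len (ev u)"
proof
  assume "len (s \<otimes> ev u) < len (ev u)"
  show "odd (count_list (refls u) s)"
  proof (rule ccontr)
    assume e: "\<not> ?thesis"
    have "conjg s s = s" using assms by (simp add: conjg_def)
    hence "odd (count_list (refls (s # u)) s)"
      using e assms set_refls[of u] by (simp add: count_map_conj)
    hence "len (s \<otimes> ev (s # u)) < len (ev (s # u))"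
      using assms by (intro len_odd_refls) auto
    thus False using \<open>len (s \<otimes> ev u) < len (ev u)\<close> assms by simp
  qed
qed (use assms in \<open>auto intro: len_odd_refls\<close>)

lemma len_left_neq:
  assumes "w \<in> carrier W" "s \<in> S"
  shows "len (s \<otimes> w) \<noteq> len w"
proof -
  obtain u where u: "u \<in> lists S" "ev u = w" using ex_word assms by blast
  have "conjg s s = s" using assms by (simp add: conjg_def)
  hence "odd (count_list (refls (s # u)) s) \<longleftrightarrow> even (count_list (refls u) s)"
    using assms u set_refls[of u] by (simp add: count_map_conj)
  thus ?thesis using left_odd_iff[of u s] left_odd_iff[of "s # u" s] u assms by auto
qed

lemma left_exchange:
  assumes "u \<in> lists S" "s \<in> S" "len (s \<otimes> ev u) < len (ev u)"
  shows "\<exists>i<length u. s \<otimes> ev u = ev (take i u @ drop (Suc i) u)"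
  using left_exchange_aux[of u s] left_odd_iff[of u s] assms by auto

lemma exchange:
  assumes "u \<in> lists S" "s \<in> S" "len (ev u \<otimes> s) < len (ev u)"
  shows "\<exists>i<length u. ev u \<otimes> s = ev (take i u @ drop (Suc i) u)"
proof -
  have r: "rev u \<in> lists S" using assms by auto
  have e: "s \<otimes> ev (rev u) = inv (ev u \<otimes> s)" using assms by (simp add: ev_rev inv_mult_group)
  have "len (s \<otimes> ev (rev u)) < len (ev (rev u))"
    unfolding e using assms by (simp add: ev_rev)
  then obtain i where i: "i < length u" "s \<otimes> ev (rev u) = ev (take i (rev u) @ drop (Suc i) (rev u))"
    using left_exchange[OF r assms(2)] by auto
  let ?j = "length u - Suc i"
  have eq: "take i (rev u) @ drop (Suc i) (rev u) = rev (take ?j u @ drop (Suc ?j) u)"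
    using i by (simp add: take_rev drop_rev Suc_diff_Suc)
  have "inv (ev u \<otimes> s) = inv (ev (take ?j u @ drop (Suc ?j) u))"
    using i(2) delete_nth_lists[OF assms(1), of ?j] unfolding e eq by (subst (asm) ev_rev)
  hence "ev u \<otimes> s = ev (take ?j u @ drop (Suc ?j) u)"
    using delete_nth_lists[OF assms(1), of ?j] assms(1,2) by (metis S_carrier ev_closed inv_inv m_closed)
  thus ?thesis using i by (intro exI[of _ ?j]) auto
qed

lemma len_right_neq:
  assumes "w \<in> carrier W" "s \<in> S"
  shows "len (w \<otimes> s) \<noteq> len w"
  using len_left_neq[of "inv w" s] assms len_inv[of "w \<otimes> s"] by (simp add: inv_mult_group)

lemma ascent_len: "w \<in> carrier W \<Longrightarrow> s \<in> S \<Longrightarrow> \<not> len (w \<otimes> s) < len w \<Longrightarrow> len (w \<otimes> s) = len w + 1"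
  using len_right_neq[of w s] len_mult_gen[of w s] by simp

lemma descent_len: "w \<in> carrier W \<Longrightarrow> s \<in> S \<Longrightarrow> len (w \<otimes> s) < len w \<Longrightarrow> len w = len (w \<otimes> s) + 1"
  using len_mult_gen_ge[of w s] by simp

lemma len_gen_eq [simp]: "s \<in> S \<Longrightarrow> len s = 1"
  using ascent_len[of \<one> s] by simp

lemma ex_descent:
  assumes "w \<in> carrier W" "w \<noteq> \<one>"
  shows "\<exists>s\<in>S. len (w \<otimes> s) < len w"
proof -
  obtain u where u: "u \<in> lists S" "length u = len w" "ev u = w" using ex_reduced_word assms by blast
  have "u \<noteq> []" using u assms by auto
  then obtain v s where vs: "u = v @ [s]" by (metis append_butlast_last_id)
  have "w \<otimes> s = ev v" using u(1,3) vs by (auto simp flip: u(3))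
  hence "len (w \<otimes> s) < len w" using u vs len_ev_le[of v] by simp
  thus ?thesis using u vs by auto
qed

end


section \<open>The numbers game\<close>

fun lalt :: "'a \<Rightarrow> 'a \<Rightarrow> nat \<Rightarrow> 'a list" where
  "lalt p q 0 = []"
| "lalt p q (Suc n) = p # lalt q p n"

lemma length_lalt [simp]: "length (lalt p q n) = n"
  by (induction n arbitrary: p q) auto

lemma lalt_lists: "p \<in> A \<Longrightarrow> q \<in> A \<Longrightarrow> lalt p q n \<in> lists A"
  by (induction n arbitrary: p q) auto

lemma lalt_add: "lalt p q (i + j) = lalt p q i @ (if even i then lalt p q j else lalt q p j)"
  by (induction i arbitrary: p q) auto

lemma lalt_snoc: "lalt p q (Suc n) = lalt p q n @ [if even n then p else q]"
  using lalt_add[of p q n 1] by simp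

lemma lalt_even: "lalt p q (2 * n) = concat (replicate n [p, q])"
  by (induction n) auto

text \<open>For positive \<open>n\<close> this is the Chebyshev polynomial of the second kind of
  degree \<open>n - 1\<close> at \<open>a / 2\<close>. Its values are the coefficients of the roots
  of a dihedral group in the two simple roots.\<close>

fun cheb :: "real \<Rightarrow> nat \<Rightarrow> real" where
  "cheb a 0 = 0"
| "cheb a (Suc 0) = 1"
| "cheb a (Suc (Suc n)) = a * cheb a (Suc n) - cheb a n"

lemma cheb_cos: "cheb (2 * cos \<theta>) n * sin \<theta> = sin (real n * \<theta>)"
proof (induction "2 * cos \<theta>" n rule: cheb.induct)
  case (3 n)
  have "cheb (2 * cos \<theta>) (Suc (Suc n)) * sin \<theta>
      = 2 * cos \<theta> * (cheb (2 * cos \<theta>) (Suc n) * sin \<theta>) - cheb (2 * cos \<theta>) n * sin \<theta>"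
    by (simp add: algebra_simps)
  also have "\<dots> = 2 * cos \<theta> * sin (real (Suc n) * \<theta>) - sin (real n * \<theta>)"
    using 3 by simp
  also have "\<dots> = sin (real (Suc n) * \<theta> + \<theta>)"
    using sin_diff[of "real (Suc n) * \<theta>" \<theta>] sin_add[of "real (Suc n) * \<theta>" \<theta>]
    by (simp add: algebra_simps)
  also have "real (Suc n) * \<theta> + \<theta> = real (Suc (Suc n)) * \<theta>" by (simp add: algebra_simps)
  finally show ?case .
qed auto

lemma cheb_two: "cheb 2 n = real n"
  by (induction "2::real" n rule: cheb.induct) auto

lemma cheb_cos_nonneg:
  assumes "2 \<le> M" "n \<le> M"
  shows "cheb (2 * cos (pi / real M)) n \<ge> 0"
    and "0 < n \<Longrightarrow> n < M \<Longrightarrow> cheb (2 * cos (pi / real M)) n > 0"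
proof -
  have sp: "sin (pi / real M) > 0" using assms by (intro sin_gt_zero) (auto simp: field_simps)
  moreover have "sin (real n * (pi / real M)) \<ge> 0"
    using assms by (intro sin_ge_zero) (auto simp: field_simps)
  moreover have c: "cheb (2 * cos (pi / real M)) n * sin (pi / real M) = sin (real n * (pi / real M))"
    by (rule cheb_cos)
  ultimately show "cheb (2 * cos (pi / real M)) n \<ge> 0"
    by (metis zero_le_mult_iff not_less)
  assume n: "0 < n" "n < M"
  have "sin (real n * (pi / real M)) > 0"
    using n by (intro sin_gt_zero) (auto simp: field_simps)
  with c sp show "cheb (2 * cos (pi / real M)) n > 0"
    by (metis zero_less_mult_pos2)
qed

text \<open>Multiplication by \<open>2 * sin \<theta>\<close> makes the first two sums telescope
  over a full period. The sums measure the total change at a third vertex when the relator of two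
  generators is played.\<close>

lemma sum_sin_odd_even:
  assumes "2 \<le> M" and \<theta>: "\<theta> = pi / real M"
  shows "(\<Sum>i<M. sin (real (2 * i + 1) * \<theta>)) = 0" and "(\<Sum>i<M. sin (real (2 * i) * \<theta>)) = 0"
    and "(\<Sum>i<M. sin (real (2 * i + 2) * \<theta>)) = 0"
proof -
  have M\<theta>: "real (2 * M) * \<theta> = 2 * pi" using assms by simp
  have sp: "sin \<theta> > 0" unfolding \<theta> using assms(1) by (intro sin_gt_zero) (auto simp: field_simps)
  have "2 * sin \<theta> * sin (real (2 * i + 1) * \<theta>) = cos (real (2 * i) * \<theta>) - cos (real (2 * Suc i) * \<theta>)" for i
    using cos_diff[of "real (2 * i + 1) * \<theta>" \<theta>] cos_add[of "real (2 * i + 1) * \<theta>" \<theta>]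
    by (simp add: algebra_simps)
  hence "2 * sin \<theta> * (\<Sum>i<M. sin (real (2 * i + 1) * \<theta>))
      = (\<Sum>i<M. cos (real (2 * i) * \<theta>) - cos (real (2 * Suc i) * \<theta>))"
    by (simp only: sum_distrib_left)
  also have "\<dots> = cos (real (2 * 0) * \<theta>) - cos (real (2 * M) * \<theta>)"
    by (rule sum_lessThan_telescope')
  also have "\<dots> = 0" unfolding M\<theta> by simp
  finally show "(\<Sum>i<M. sin (real (2 * i + 1) * \<theta>)) = 0" using sp by simp
  have "2 * sin \<theta> * sin (real (2 * i) * \<theta>) = cos (real (2 * i) * \<theta> - \<theta>) - cos (real (2 * Suc i) * \<theta> - \<theta>)" for i
    using cos_diff[of "real (2 * i) * \<theta>" \<theta>] cos_add[of "real (2 * i) * \<theta>" \<theta>]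
    by (simp add: algebra_simps)
  hence "2 * sin \<theta> * (\<Sum>i<M. sin (real (2 * i) * \<theta>))
      = (\<Sum>i<M. cos (real (2 * i) * \<theta> - \<theta>) - cos (real (2 * Suc i) * \<theta> - \<theta>))"
    by (simp only: sum_distrib_left)
  also have "\<dots> = cos (real (2 * 0) * \<theta> - \<theta>) - cos (real (2 * M) * \<theta> - \<theta>)"
    by (rule sum_lessThan_telescope')
  also have "\<dots> = 0" unfolding M\<theta> by (simp add: cos_diff)
  finally show e: "(\<Sum>i<M. sin (real (2 * i) * \<theta>)) = 0" using sp by simp
  have "(\<Sum>i<M. sin (real (2 * Suc i) * \<theta>) - sin (real (2 * i) * \<theta>))
      = sin (real (2 * M) * \<theta>) - sin (real (2 * 0) * \<theta>)"
    by (rule sum_lessThan_telescope)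
  also have "\<dots> = 0" unfolding M\<theta> by simp
  finally show "(\<Sum>i<M. sin (real (2 * i + 2) * \<theta>)) = 0"
    using e by (simp add: sum_subtractf)
qed

context coxeter_system
begin

text \<open>This is -2 times the canonical bilinear form on simple roots. As
  \<open>m s s = 1\<close>, the formula gives -2 on the diagonal, so \<open>fire\<close> negates the
  fired value without a case distinction; 2 is the limit value for infinite
  \<open>m s t\<close>.\<close>

definition bond :: "'a \<Rightarrow> 'a \<Rightarrow> real" where
  "bond s t = (case m s t of enat k \<Rightarrow> 2 * cos (pi / real k) | \<infinity> \<Rightarrow> 2)"

lemma bond_self: "s \<in> S \<Longrightarrow> bond s s = -2"
  by (simp add: bond_def m_self one_enat_def)

lemma bond_sym: "s \<in> S \<Longrightarrow> t \<in> S \<Longrightarrow> bond s t = bond t s"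
  by (simp add: bond_def m_sym)

lemma bond_nonneg:
  assumes "s \<in> S" "t \<in> S" "s \<noteq> t"
  shows "bond s t \<ge> 0"
proof (cases "m s t")
  case (enat k)
  hence "2 \<le> k" using m_ge_2[OF assms] by (simp add: numeral_eq_enat)
  hence "0 \<le> pi / real k" "pi / real k \<le> pi / 2" by (auto simp: field_simps)
  hence "cos (pi / real k) \<ge> 0" using pi_ge_zero by (intro cos_ge_zero) linarith+
  thus ?thesis using enat by (simp add: bond_def)
qed (simp add: bond_def)

lemma bond_ge_1:
  assumes "3 \<le> m s t"
  shows "bond s t \<ge> 1"
proof (cases "m s t")
  case (enat k)
  hence k: "3 \<le> k" using assms by (simp add: numeral_eq_enat)
  have "cos (pi / 3) \<le> cos (pi / real k)"
    using k by (intro cos_monotone_0_pi_le) (auto simp: field_simps)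
  thus ?thesis using enat by (simp add: bond_def cos_60)
qed (simp add: bond_def)

lemma m_eq_2:
  assumes "s \<in> S" "t \<in> S" "s \<noteq> t" "\<not> 3 \<le> m s t"
  shows "m s t = enat 2"
proof (cases "m s t")
  case (enat k)
  hence "2 \<le> k" "\<not> 3 \<le> k" using assms m_ge_2[of s t] by (simp_all add: numeral_eq_enat)
  thus ?thesis using enat by simp
qed (use assms in simp)

lemma bond_eq_0: "s \<in> S \<Longrightarrow> t \<in> S \<Longrightarrow> s \<noteq> t \<Longrightarrow> \<not> 3 \<le> m s t \<Longrightarrow> bond s t = 0"
  by (simp add: bond_def m_eq_2)

lemma gens_commute:
  assumes "s \<in> S" "t \<in> S" "\<not> 3 \<le> m s t"
  shows "s \<otimes> t = t \<otimes> s"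
proof (cases "s = t")
  case False
  have "s \<otimes> (t \<otimes> (s \<otimes> t)) = \<one>"
    using ev_relator[OF assms(1,2) m_eq_2[OF assms(1,2) False assms(3)]] assms
    by (simp add: numeral_2_eq_2)
  hence "inv (s \<otimes> t) = s \<otimes> t" using assms by (intro inv_equality) (simp_all add: m_assoc)
  thus ?thesis using assms by (simp add: inv_mult_group)
qed simp

text \<open>A move of the numbers game of Mozes, which is the contragredient of the geometric
  representation written in coordinates.\<close>

definition fire :: "('a \<Rightarrow> real) \<Rightarrow> 'a \<Rightarrow> 'a \<Rightarrow> real" where
  "fire z s = (\<lambda>t. z t + bond s t * z s)"

definition zact :: "('a \<Rightarrow> real) \<Rightarrow> 'a list \<Rightarrow> 'a \<Rightarrow> real" where
  "zact = foldl fire"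

lemma zact_Nil [simp]: "zact z [] = z"
  and zact_Cons [simp]: "zact z (s # u) = zact (fire z s) u"
  and zact_append [simp]: "zact z (u @ v) = zact (zact z u) v"
  by (simp_all add: zact_def)

lemma fire_fire:
  assumes "s \<in> S"
  shows "fire (fire z s) s = z"
  using bond_self[OF assms] by (auto simp: fire_def algebra_simps fun_eq_iff)

lemma fire_self: "s \<in> S \<Longrightarrow> fire z s s = - z s"
  by (simp add: fire_def bond_self)

text \<open>The play has a closed form: the values at \<open>s\<close> and \<open>t\<close> follow a
  second-order recurrence of period \<open>2 * k\<close>, and every other vertex collects multiples
  of sums over that period, which vanish.\<close>

lemma zact_relator_distinct:
  assumes st: "s \<in> S" "t \<in> S" "s \<noteq> t" and k: "m s t = enat k"
  shows "zact z (concat (replicate k [s, t])) = z"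
proof -
  define \<theta> where "\<theta> = pi / real k"
  have k2: "2 \<le> k" using m_ge_2[OF st] k by (simp add: numeral_eq_enat)
  have sp: "sin \<theta> > 0" using k2 by (auto intro!: sin_gt_zero simp: field_simps \<theta>_def)
  \<comment> \<open>The solution of the recurrence with \<open>g 0 = - z t\<close> and
    \<open>g 1 = z s\<close>; for positive \<open>i\<close>, \<open>g i\<close> is the value fired
    in the i-th move.\<close>
  define g where "g i = (z s * sin (real i * \<theta>) + z t * sin (real i * \<theta> - \<theta>)) / sin \<theta>" for i :: nat
  have g_rec: "g (Suc (Suc i)) = bond s t * g (Suc i) - g i" for i
  proof -
    have b: "bond s t = 2 * cos \<theta>" using k by (simp add: bond_def \<theta>_def)
    have *: "sin (x + \<theta>) = 2 * cos \<theta> * sin x - sin (x - \<theta>)" for x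
      by (simp add: sin_add sin_diff)
    have e: "real (Suc (Suc i)) * \<theta> = real (Suc i) * \<theta> + \<theta>" "real i * \<theta> = real (Suc i) * \<theta> - \<theta>"
      by (simp_all add: algebra_simps)
    have 1: "sin (real (Suc (Suc i)) * \<theta> - \<theta>) = 2 * cos \<theta> * sin (real (Suc i) * \<theta> - \<theta>) - sin (real i * \<theta> - \<theta>)"
      using *[of "real (Suc i) * \<theta> - \<theta>"] unfolding e by simp
    have 2: "sin (real (Suc (Suc i)) * \<theta>) = 2 * cos \<theta> * sin (real (Suc i) * \<theta>) - sin (real i * \<theta>)"
      using *[of "real (Suc i) * \<theta>"] unfolding e by simp
    have "z s * (c * a - a') + z t * (c * b - b') = c * (z s * a + z t * b) - (z s * a' + z t * b')"
      for a a' b b' c :: real by (simp add: algebra_simps)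
    thus ?thesis unfolding g_def b 1 2 by (simp add: diff_divide_distrib)
  qed
  have bts: "bond t s = bond s t" using st by (simp add: bond_sym)
  \<comment> \<open>The position after \<open>j\<close> rounds. The sign at \<open>t\<close> arises
    because \<open>t\<close> is fired last in a round and thereby negated.\<close>
  define state where "state j = (\<lambda>r. if r = s then g (2 * j + 1) else if r = t then - g (2 * j)
     else z r + bond s r * (\<Sum>i<j. g (2 * i + 1)) + bond t r * (\<Sum>i<j. g (2 * i + 2)))" for j
  have step: "fire (fire (state j) s) t = state (Suc j)" for j
  proof
    fix r
    have 1: "fire (state j) s t = g (2 * j + 2)"
      using st g_rec[of "2 * j"] by (simp add: fire_def state_def)
    have 2: "fire (state j) s s = - g (2 * j + 1)"
      using st by (simp add: fire_self state_def)
    have "fire (fire (state j) s) t r = fire (state j) s r + bond t r * g (2 * j + 2)"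
      unfolding fire_def[of "fire (state j) s"] 1 ..
    also have "\<dots> = state (Suc j) r"
    proof (cases "r = s")
      case True
      thus ?thesis using 2 g_rec[of "2 * j + 1"] by (simp add: state_def bts)
    next
      case False
      show ?thesis
      proof (cases "r = t")
        case True
        thus ?thesis using 1 st by (simp add: bond_self state_def)
      next
        case False
        with \<open>r \<noteq> s\<close> show ?thesis by (simp add: fire_def state_def algebra_simps)
      qed
    qed
    finally show "fire (fire (state j) s) t r = state (Suc j) r" .
  qed
  have g0: "g 0 = - z t" "g 1 = z s" using sp by (simp_all add: g_def)
  have "state 0 = z" using g0 by (auto simp: state_def)
  moreover have "zact (state i) (concat (replicate j [s, t])) = state (i + j)" for i j
  proof (induction j arbitrary: i)
    case (Suc j)
    thus ?case using step[of i] by simp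
  qed simp
  ultimately have "zact z (concat (replicate k [s, t])) = state k" by (metis add_0)
  also have "state k = z"
  proof
    fix r
    have k\<theta>: "real k * \<theta> = pi" using k2 by (simp add: \<theta>_def)
    have sin_per: "sin (x + real (2 * k) * \<theta>) = sin x" for x
    proof -
      have e: "real (2 * k) * \<theta> = 2 * pi" using k\<theta> by simp
      show ?thesis unfolding e by simp
    qed
    have "g (2 * k + i) = g i" for i
    proof -
      have "real (2 * k + i) * \<theta> = real i * \<theta> + real (2 * k) * \<theta>" by (simp add: algebra_simps)
      moreover from this have "real (2 * k + i) * \<theta> - \<theta> = (real i * \<theta> - \<theta>) + real (2 * k) * \<theta>" by simp
      ultimately show ?thesis unfolding g_def by (simp only: sin_per)
    qed
    from this[of 0] this[of 1] have per: "g (2 * k) = - z t" "g (2 * k + 1) = z s" using g0 by simp_all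
    have o: "(\<Sum>i<k. g (2 * i + 1)) = 0" and e: "(\<Sum>i<k. g (2 * i + 2)) = 0"
    proof -
      have 1: "g (2 * i + 1) = (z s * sin (real (2 * i + 1) * \<theta>) + z t * sin (real (2 * i) * \<theta>)) / sin \<theta>" for i
        by (simp add: g_def algebra_simps)
      have 2: "g (2 * i + 2) = (z s * sin (real (2 * i + 2) * \<theta>) + z t * sin (real (2 * i + 1) * \<theta>)) / sin \<theta>" for i
        by (simp add: g_def algebra_simps)
      note sums = sum_sin_odd_even[OF k2 \<theta>_def]
      show "(\<Sum>i<k. g (2 * i + 1)) = 0"
        unfolding 1 sum_divide_distrib[symmetric] sum.distrib sum_distrib_left[symmetric] sums by simp
      show "(\<Sum>i<k. g (2 * i + 2)) = 0"
        unfolding 2 sum_divide_distrib[symmetric] sum.distrib sum_distrib_left[symmetric] sums by simp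
    qed
    show "state k r = z r" unfolding state_def o e per by simp
  qed
  finally show ?thesis .
qed

lemma zact_relator:
  assumes "s \<in> S" "t \<in> S" "m s t = enat k"
  shows "zact z (concat (replicate k [s, t])) = z"
proof (cases "s = t")
  case True
  hence "k = 1" using assms by (simp add: m_self one_enat_def)
  thus ?thesis using True assms by (simp add: fire_fire)
qed (use zact_relator_distinct assms in blast)

lemma zact_cong:
  assumes "u \<in> lists S" "v \<in> lists S" "ev u = ev v"
  shows "zact z u = zact z v"
  using assms by (rule word_invariant) (simp add: zact_relator)

section \<open>Signs of values and descents\<close>

abbreviation desc :: "'a \<Rightarrow> 'a \<Rightarrow> bool" where
  "desc w s \<equiv> len (w \<otimes> s) < len w"

text \<open>Paired with \<open>z\<close>, this expands in \<alpha>_p and \<alpha>_q the image of the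
  simple root of the letter that would continue the alternating word.\<close>

lemma zact_lalt:
  assumes "p \<in> S" "q \<in> S"
  shows "zact z (lalt p q n) (if even n then p else q) = cheb (bond p q) (Suc n) * z p + cheb (bond p q) n * z q"
  using assms
proof (induction n arbitrary: p q z)
  case (Suc n)
  from Suc.IH[of q p "fire z p"] Suc.prems show ?case
    by (simp add: fire_self) (simp add: fire_def bond_sym[of q p] algebra_simps split: if_splits)
qed simp

text \<open>By the relation, the first \<open>M + 1\<close> letters have the value of the inverse of
  the other \<open>M - 1\<close> letters of the relator, so an alternating word of more than
  \<open>M\<close> letters is not reduced.\<close>

lemma len_lalt_bound:
  assumes pq: "p \<in> S" "q \<in> S" "p \<noteq> q" "m p q = enat M" and n: "len (ev (lalt p q n)) = n"
  shows "n \<le> M"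
proof (rule ccontr)
  assume "\<not> n \<le> M"
  hence nM: "n = (M + 1) + (n - M - 1)" by simp
  have M2: "2 \<le> M" using m_ge_2[OF pq(1-3)] pq(4) by (simp add: numeral_eq_enat)
  note l = lalt_lists[of _ S]
  obtain v where v: "v \<in> lists S" "length v = M - 1" "lalt p q (2 * M) = lalt p q (M + 1) @ v"
  proof
    show "(if even (M + 1) then lalt p q (M - 1) else lalt q p (M - 1)) \<in> lists S"
      using pq l by simp
    show "lalt p q (2 * M) = lalt p q (M + 1) @ (if even (M + 1) then lalt p q (M - 1) else lalt q p (M - 1))"
      using lalt_add[of p q "M + 1" "M - 1"] M2 by (simp add: mult_2)
  qed simp
  have "ev (lalt p q (M + 1)) \<otimes> ev v = \<one>"
    using ev_relator[OF pq(1,2,4)] unfolding lalt_even[symmetric] v(3) ev_append[OF l[OF pq(1,2)] v(1)] .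
  hence "ev (lalt p q (M + 1)) = inv (ev v)"
    by (intro inv_equality[symmetric]) (use v(1) l[OF pq(1,2)] in \<open>blast intro: ev_closed\<close>)+
  hence 1: "len (ev (lalt p q (M + 1))) \<le> M - 1" using len_ev_le[OF v(1)] v by simp
  obtain v' where v': "v' \<in> lists S" "length v' = n - M - 1" "lalt p q n = lalt p q (M + 1) @ v'"
  proof
    show "(if even (M + 1) then lalt p q (n - M - 1) else lalt q p (n - M - 1)) \<in> lists S"
      using pq l by simp
    show "lalt p q n = lalt p q (M + 1) @ (if even (M + 1) then lalt p q (n - M - 1) else lalt q p (n - M - 1))"
      using lalt_add[of p q "M + 1" "n - M - 1"] nM by simp
  qed simp
  have "len (ev (lalt p q n)) \<le> len (ev (lalt p q (M + 1))) + len (ev v')"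
    unfolding v'(3) ev_append[OF l[OF pq(1,2)] v'(1)]
    by (rule len_mult) (rule ev_closed, use l[OF pq(1,2)] v'(1) in blast)+
  also have "\<dots> \<le> (M - 1) + (n - M - 1)" using 1 len_ev_le[OF v'(1)] v' by simp
  finally show False using n nM M2 by simp
qed

text \<open>Stripping \<open>t\<close> makes \<open>t\<close> an ascent, after which
  \<open>s\<close> and \<open>t\<close> exchange roles; the process ends at the shortest element
  \<open>v\<close> of the coset. The last clause says that \<open>s\<close> would continue the
  alternating word.\<close>

lemma dihedral_decomp:
  assumes "w \<in> carrier W" "s \<in> S" "t \<in> S" "s \<noteq> t" "\<not> desc w s"
  shows "\<exists>v p q k. v \<in> carrier W \<and> (p = s \<and> q = t \<or> p = t \<and> q = s) \<and> w = v \<otimes> ev (lalt p q k) \<and>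
    len w = len v + k \<and> \<not> desc v s \<and> \<not> desc v t \<and> (if even k then p else q) = s"
  using assms
proof (induction "len w" arbitrary: w s t rule: less_induct)
  case less
  show ?case
  proof (cases "desc w t")
    case False
    thus ?thesis using less.prems by (intro exI[of _ w] exI[of _ s] exI[of _ t] exI[of _ 0]) auto
  next
    case True
    define w' where "w' = w \<otimes> t"
    have w': "w' \<in> carrier W" "len w' < len w" "w = w' \<otimes> t" "\<not> desc w' t" "len w = len w' + 1"
      using less.prems True descent_len[of w t] by (auto simp: w'_def)
    obtain v p q k where v: "v \<in> carrier W" "p = t \<and> q = s \<or> p = s \<and> q = t" "w' = v \<otimes> ev (lalt p q k)"
      "len w' = len v + k" "\<not> desc v s" "\<not> desc v t" "(if even k then p else q) = t"
      using less.hyps[OF w'(2,1) less.prems(3,2) _ w'(4)] less.prems(4) by blast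
    have l: "lalt p q k \<in> lists S" using v(2) less.prems by (auto intro!: lalt_lists)
    have "ev (lalt p q (Suc k)) = ev (lalt p q k) \<otimes> t"
      unfolding lalt_snoc v(7) using l less.prems by simp
    hence "w = v \<otimes> ev (lalt p q (Suc k))"
      using v(1,3) w'(3) l less.prems by (simp add: m_assoc)
    moreover have "(if even (Suc k) then p else q) = s" using v(2,7) less.prems(4) by (auto split: if_splits)
    moreover have "len w = len v + Suc k" using v(4) w'(5) by simp
    moreover have "p = s \<and> q = t \<or> p = t \<and> q = s" using v(2) by blast
    ultimately show ?thesis using v(1,5,6) by blast
  qed
qed

text \<open>\<open>zact z u s\<close> is the pairing of \<open>z\<close> with the root \<open>w \<alpha>\<^sub>s\<close> for \<open>w = ev u\<close>, so this is the
  statement that \<open>w \<alpha>\<^sub>s\<close> is a positive root if \<open>w < w s\<close>.\<close>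

theorem zact_pos:
  assumes "u \<in> lists S" "\<And>t. t \<in> S \<Longrightarrow> z t > 0" "s \<in> S" "\<not> desc (ev u) s"
  shows "zact z u s > 0"
  using assms(1,3,4)
proof (induction "len (ev u)" arbitrary: u s rule: less_induct)
  case less
  show ?case
  proof (cases "ev u = \<one>")
    case True
    thus ?thesis using zact_cong[of u "[]" z] less.prems assms(2) by simp
  next
    case False
    \<comment> \<open>With a descent \<open>t\<close>, the coset for \<open>s\<close> and
      \<open>t\<close> has a strictly shorter minimal element \<open>v\<close>, where the induction
      hypothesis gives positive values at both letters.\<close>
    then obtain t where t: "t \<in> S" "desc (ev u) t" using ex_descent less.prems by (metis ev_closed)
    have st: "s \<noteq> t" using t less.prems by auto
    obtain v p q k where v: "v \<in> carrier W" "p = s \<and> q = t \<or> p = t \<and> q = s" "ev u = v \<otimes> ev (lalt p q k)"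
      "len (ev u) = len v + k" "\<not> desc v s" "\<not> desc v t" "(if even k then p else q) = s"
      using dihedral_decomp[OF ev_closed[OF less.prems(1)] less.prems(2) t(1) st less.prems(3)] by blast
    obtain u' where u': "u' \<in> lists S" "ev u' = v" using ex_word v by blast
    have pq: "p \<in> S" "q \<in> S" "p \<noteq> q" using v(2) st t less.prems by auto
    have l: "lalt p q n \<in> lists S" for n using pq by (auto intro!: lalt_lists)
    have k: "k \<noteq> 0"
    proof
      assume "k = 0"
      hence "ev u = v" using v by simp
      thus False using v t by simp
    qed
    hence "len (ev u') < len (ev u)" using v u' by simp
    hence pos: "zact z u' s > 0" "zact z u' t > 0"
      using less.hyps[of u' s] less.hyps[of u' t] u' v less.prems t by auto
    have "ev (lalt p q (Suc k)) = ev (lalt p q k) \<otimes> s"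
      unfolding lalt_snoc v(7) using l less.prems by simp
    hence "ev u \<otimes> s = v \<otimes> ev (lalt p q (Suc k))" using v(1,3) l less.prems by (simp add: m_assoc)
    moreover have "len (ev u \<otimes> s) = len v + Suc k"
      using ascent_len[OF ev_closed[OF less.prems(1)] less.prems(2,3)] v(4) by simp
    ultimately have "len v + Suc k \<le> len v + len (ev (lalt p q (Suc k)))"
      using len_mult[OF v(1) ev_closed[OF l, of "Suc k"]] by metis
    hence len_l: "len (ev (lalt p q (Suc k))) = Suc k"
      using len_ev_le[OF l, of "Suc k"] by simp
    \<comment> \<open>Since \<open>s\<close> is an ascent, the alternating word of length
      \<open>k + 1\<close> is reduced, hence \<open>k + 1 \<le> M\<close> for finite
      \<open>M\<close>: the range in which the sines stay nonnegative.\<close>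
    have c: "cheb (bond p q) (Suc k) \<ge> 0 \<and> cheb (bond p q) k > 0"
    proof (cases "m p q")
      case (enat M)
      have "Suc k \<le> M" using len_lalt_bound[OF pq enat len_l] .
      moreover have "2 \<le> M" using m_ge_2[OF pq] enat by (simp add: numeral_eq_enat)
      ultimately show ?thesis using k enat by (auto simp: bond_def intro!: cheb_cos_nonneg)
    next
      case infinity
      thus ?thesis using k by (simp add: bond_def cheb_two)
    qed
    have "zact z u = zact z (u' @ lalt p q k)"
      using less.prems u' l v by (intro zact_cong) auto
    hence "zact z u s = cheb (bond p q) (Suc k) * zact z u' p + cheb (bond p q) k * zact z u' q"
      using zact_lalt[OF pq(1,2), of "zact z u'" k] v(7) by simp
    moreover have "zact z u' p > 0" "zact z u' q > 0" using pos v(2) by auto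
    ultimately show ?thesis using c by (simp add: add_nonneg_pos)
  qed
qed

lemma zact_neg:
  assumes "u \<in> lists S" "\<And>t. t \<in> S \<Longrightarrow> z t > 0" "s \<in> S" "desc (ev u) s"
  shows "zact z u s < 0"
proof -
  have "ev (u @ [s]) \<otimes> s = ev u" using assms by simp
  hence "zact z (u @ [s]) s > 0" using assms by (intro zact_pos) auto
  thus ?thesis using assms by (simp add: fire_self)
qed

lemma desc_iff_zact_neg:
  assumes "u \<in> lists S" "\<And>t. t \<in> S \<Longrightarrow> z t > 0" "s \<in> S"
  shows "desc (ev u) s \<longleftrightarrow> zact z u s < 0"
  using zact_neg[OF assms] zact_pos[OF assms] by force

end


section \<open>Parabolic subgroups and the weak orders\<close>

context coxeter_system
begin

definition parabolic :: "'a set \<Rightarrow> 'a set" where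
  "parabolic J = ev ` lists J"

lemma lists_subsetD: "u \<in> lists J \<Longrightarrow> J \<subseteq> S \<Longrightarrow> u \<in> lists S"
  using lists_mono[of J S] by blast

lemma parabolic_carrier: "J \<subseteq> S \<Longrightarrow> d \<in> parabolic J \<Longrightarrow> d \<in> carrier W"
  by (auto simp: parabolic_def dest: lists_subsetD)

lemma parabolic_one [simp]: "\<one> \<in> parabolic J"
  unfolding parabolic_def by (rule image_eqI[of _ _ "[]"]) auto

lemma parabolic_mult: "J \<subseteq> S \<Longrightarrow> d \<in> parabolic J \<Longrightarrow> d' \<in> parabolic J \<Longrightarrow> d \<otimes> d' \<in> parabolic J"
  unfolding parabolic_def
proof safe
  fix u v assume *: "J \<subseteq> S" "u \<in> lists J" "v \<in> lists J"
  hence "u \<in> lists S" "v \<in> lists S" by (auto dest: lists_subsetD)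
  thus "ev u \<otimes> ev v \<in> ev ` lists J"
    using * by (intro image_eqI[of _ _ "u @ v"]) auto
qed

lemma parabolic_inv: "J \<subseteq> S \<Longrightarrow> d \<in> parabolic J \<Longrightarrow> inv d \<in> parabolic J"
  unfolding parabolic_def
proof safe
  fix u assume *: "J \<subseteq> S" "u \<in> lists J"
  hence "u \<in> lists S" by (auto dest: lists_subsetD)
  thus "inv (ev u) \<in> ev ` lists J"
    using * by (intro image_eqI[of _ _ "rev u"]) (auto simp: ev_rev)
qed

lemma parabolic_gen: "j \<in> J \<Longrightarrow> J \<subseteq> S \<Longrightarrow> j \<in> parabolic J"
  unfolding parabolic_def by (rule image_eqI[of _ _ "[j]"]) auto

text \<open>Exchange only deletes letters, so shortening a word over \<open>J\<close> introduces no
  letter outside \<open>J\<close>.\<close>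

lemma parabolic_reduced_word:
  assumes "J \<subseteq> S" "d \<in> parabolic J"
  shows "\<exists>v\<in>lists J. ev v = d \<and> length v = len d"
proof -
  have "\<exists>v\<in>lists J. ev v = ev u \<and> length v = len (ev u)" if "u \<in> lists J" for u
    using that
  proof (induction u rule: rev_induct)
    case Nil
    show ?case by (intro bexI[of _ "[]"]) auto
  next
    case (snoc s u)
    then obtain v where v: "v \<in> lists J" "ev v = ev u" "length v = len (ev u)" by auto
    have S: "v \<in> lists S" "u \<in> lists S" "s \<in> S" "s \<in> J"
      using v snoc.prems assms(1) by (auto dest: lists_subsetD)
    show ?case
    proof (cases "desc (ev v) s")
      case True
      then obtain i where i: "i < length v" "ev v \<otimes> s = ev (take i v @ drop (Suc i) v)"
        using exchange[OF S(1,3) True] by blast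
      have "length (take i v @ drop (Suc i) v) = len (ev v \<otimes> s)"
        unfolding length_delete_nth[OF i(1)] v(3) v(2)[symmetric]
        using descent_len[OF _ S(3) True] S(1) by simp
      moreover have "ev (take i v @ drop (Suc i) v) = ev (u @ [s])" using i(2) S v(2) by simp
      ultimately show ?thesis using delete_nth_lists[OF v(1), of i] i(2) by metis
    next
      case False
      thus ?thesis using ascent_len[of "ev v" s] S v by (intro bexI[of _ "v @ [s]"]) auto
    qed
  qed
  thus ?thesis using assms(2) by (auto simp: parabolic_def)
qed

text \<open>Firing is linear, and when a letter of \<open>J\<close> is fired the new values on
  \<open>J\<close> depend only on the old values on \<open>J\<close>.\<close>

lemma zact_scale:
  assumes "u \<in> lists J" "\<And>j. j \<in> J \<Longrightarrow> z' j = c * z j" "j \<in> J"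
  shows "zact z' u j = c * zact z u j"
  using assms
proof (induction u arbitrary: z z')
  case (Cons s u)
  have "fire z' s i = c * fire z s i" if "i \<in> J" for i
  proof -
    have "s \<in> J" using Cons.hyps by simp
    thus ?thesis using Cons.prems(1) that by (simp add: fire_def algebra_simps)
  qed
  with Cons show ?case by auto
qed simp

text \<open>The values on \<open>J\<close> after a word for \<open>x\<close> become positive when
  multiplied by \<open>c\<close>. Extended by 1 outside \<open>J\<close>, they form a legitimate
  start, from which playing \<open>v\<close> decides the descents of \<open>ev v\<close>. The
  instances are \<open>c = 1\<close> and \<open>c = -1\<close>.\<close>

lemma desc_parabolic_aux:
  assumes x: "x \<in> carrier W" and J: "J \<subseteq> S" and v: "v \<in> lists J" and j: "j \<in> J"
    and c: "\<And>z u i. (\<And>t. t \<in> S \<Longrightarrow> z t > 0) \<Longrightarrow> u \<in> lists S \<Longrightarrow> ev u = x \<Longrightarrow> i \<in> J \<Longrightarrow> c * zact z u i > 0"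
  shows "\<exists>z u. (\<forall>t\<in>S. z t > 0) \<and> u \<in> lists S \<and> ev u = x \<and> (desc (ev v) j \<longleftrightarrow> c * zact z (u @ v) j < 0)"
proof -
  obtain u where u: "u \<in> lists S" "ev u = x" using ex_word x by blast
  define z :: "'a \<Rightarrow> real" where "z = (\<lambda>_. 1)"
  define z' where "z' t = (if t \<in> J then c * zact z u t else 1)" for t
  have z': "z' t > 0" for t using c[of z u t] u by (auto simp: z'_def z_def)
  have "desc (ev v) j \<longleftrightarrow> zact z' v j < 0"
    using z' v j J by (intro desc_iff_zact_neg) (auto dest: lists_subsetD)
  also have "zact z' v j = c * zact z (u @ v) j"
    using zact_scale[OF v, of z' c "zact z u" j] j by (simp add: z'_def)
  finally show ?thesis using u by (intro exI[of _ z] exI[of _ u]) (auto simp: z_def)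
qed

lemma desc_parabolic_asc:
  assumes "x \<in> carrier W" "J \<subseteq> S" "v \<in> lists J" "j \<in> J" "\<And>i. i \<in> J \<Longrightarrow> \<not> desc x i"
  shows "desc (x \<otimes> ev v) j \<longleftrightarrow> desc (ev v) j"
proof -
  have "1 * zact z u i > 0"
    if "\<And>t. t \<in> S \<Longrightarrow> z t > 0" "u \<in> lists S" "ev u = x" "i \<in> J" for z u i
    using zact_pos[of u z i] that assms(2,5) by auto
  from desc_parabolic_aux[OF assms(1-4) this]
  obtain z u where z: "\<forall>t\<in>S. z t > 0" "u \<in> lists S" "ev u = x"
      "desc (ev v) j \<longleftrightarrow> 1 * zact z (u @ v) j < 0"
    by blast
  have "v \<in> lists S" using assms by (auto dest: lists_subsetD)
  thus ?thesis using desc_iff_zact_neg[of "u @ v" z j] z assms(2,4) by auto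
qed

lemma desc_parabolic_desc:
  assumes "x \<in> carrier W" "J \<subseteq> S" "v \<in> lists J" "j \<in> J" "\<And>i. i \<in> J \<Longrightarrow> desc x i"
  shows "desc (x \<otimes> ev v) j \<longleftrightarrow> \<not> desc (ev v) j"
proof -
  have "-1 * zact z u i > 0"
    if "\<And>t. t \<in> S \<Longrightarrow> z t > 0" "u \<in> lists S" "ev u = x" "i \<in> J" for z u i
    using zact_neg[of u z i] that assms(2,5) by auto
  from desc_parabolic_aux[OF assms(1-4) this]
  obtain z u where z: "\<forall>t\<in>S. z t > 0" "u \<in> lists S" "ev u = x"
      "desc (ev v) j \<longleftrightarrow> -1 * zact z (u @ v) j < 0"
    by blast
  have v: "v \<in> lists S" using assms by (auto dest: lists_subsetD)
  have "desc (x \<otimes> ev v) j \<longleftrightarrow> zact z (u @ v) j < 0"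
    using desc_iff_zact_neg[of "u @ v" z j] z v assms(2,4) by auto
  moreover have "zact z (u @ v) j \<noteq> 0"
  proof (cases "desc (ev (u @ v)) j")
    case True
    thus ?thesis using zact_neg[of "u @ v" z j] z(1,2) v assms(2,4) by auto
  next
    case False
    thus ?thesis using zact_pos[of "u @ v" z j] z(1,2) v assms(2,4) by auto
  qed
  ultimately show ?thesis using z(4) by auto
qed

lemma len_parabolic_asc:
  assumes "x \<in> carrier W" "J \<subseteq> S" "d \<in> parabolic J" "\<And>i. i \<in> J \<Longrightarrow> \<not> desc x i"
  shows "len (x \<otimes> d) = len x + len d"
proof -
  have *: "len (x \<otimes> ev v) = len x + length v" if "v \<in> lists J" "length v = len (ev v)" for v
    using that
  proof (induction v rule: rev_induct)
    case (snoc s v)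
    have S: "v \<in> lists S" "s \<in> S" "v \<in> lists J" "s \<in> J"
      using snoc.prems assms(2) by (auto dest: lists_subsetD)
    have "length v + 1 = len (ev v \<otimes> s)" using snoc.prems S by simp
    hence l: "length v = len (ev v)" and nd: "\<not> desc (ev v) s"
      using len_mult_gen[of "ev v" s] len_ev_le[OF S(1)] S by auto
    have "\<not> desc (x \<otimes> ev v) s" using desc_parabolic_asc[OF assms(1,2) S(3,4) assms(4)] nd by simp
    thus ?case using ascent_len[of "x \<otimes> ev v" s] snoc.IH[OF S(3) l] S assms(1) by (simp add: m_assoc)
  qed (use assms(1) in simp)
  obtain v where "v \<in> lists J" "ev v = d" "length v = len d"
    using parabolic_reduced_word[OF assms(2,3)] by blast
  thus ?thesis using *[of v] by simp
qed

lemma len_parabolic_desc: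
  assumes "x \<in> carrier W" "J \<subseteq> S" "d \<in> parabolic J" "\<And>i. i \<in> J \<Longrightarrow> desc x i"
  shows "len (x \<otimes> d) + len d = len x"
proof -
  have *: "len (x \<otimes> ev v) + length v = len x" if "v \<in> lists J" "length v = len (ev v)" for v
    using that
  proof (induction v rule: rev_induct)
    case (snoc s v)
    have S: "v \<in> lists S" "s \<in> S" "v \<in> lists J" "s \<in> J"
      using snoc.prems assms(2) by (auto dest: lists_subsetD)
    have "length v + 1 = len (ev v \<otimes> s)" using snoc.prems S by simp
    hence l: "length v = len (ev v)" and nd: "\<not> desc (ev v) s"
      using len_mult_gen[of "ev v" s] len_ev_le[OF S(1)] S by auto
    have "desc (x \<otimes> ev v) s" using desc_parabolic_desc[OF assms(1,2) S(3,4) assms(4)] nd by simp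
    thus ?case using descent_len[of "x \<otimes> ev v" s] snoc.IH[OF S(3) l] S assms(1) by (simp add: m_assoc)
  qed (use assms(1) in simp)
  obtain v where "v \<in> lists J" "ev v = d" "length v = len d"
    using parabolic_reduced_word[OF assms(2,3)] by blast
  thus ?thesis using *[of v] by simp
qed

lemma parabolic_decomp:
  assumes "h \<in> carrier W" "J \<subseteq> S"
  shows "\<exists>v\<in>carrier W. \<exists>d\<in>parabolic J. h = v \<otimes> d \<and> (\<forall>j\<in>J. \<not> desc v j)"
  using assms(1)
proof (induction "len h" arbitrary: h rule: less_induct)
  case less
  show ?case
  proof (cases "\<exists>j\<in>J. desc h j")
    case False
    thus ?thesis using less.prems by (intro bexI[of _ h] bexI[of _ \<one>]) auto
  next
    case True
    then obtain j where j: "j \<in> J" "desc h j" by blast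
    hence jS: "j \<in> S" using assms(2) by auto
    obtain v d where v: "v \<in> carrier W" "d \<in> parabolic J" "h \<otimes> j = v \<otimes> d" "\<forall>j\<in>J. \<not> desc v j"
      using less.hyps[OF j(2)] less.prems jS by auto
    have d: "d \<in> carrier W" using v assms(2) parabolic_carrier by blast
    have "h = h \<otimes> j \<otimes> j" using less.prems jS by simp
    also have "\<dots> = v \<otimes> (d \<otimes> j)" unfolding v(3) using v(1) d jS by (simp add: m_assoc)
    finally show ?thesis
      using v parabolic_mult[OF assms(2) v(2) parabolic_gen[OF j(1) assms(2)]] by blast
  qed
qed

text \<open>An element with all of \<open>J\<close> as descents loses \<open>len x\<close> under
  right multiplication by a parabolic \<open>x\<close>. Going from \<open>d\<close> to
  \<open>d'\<close> and back loses this length twice, so it is 0.\<close>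

lemma parabolic_longest_unique:
  assumes "J \<subseteq> S" "d \<in> parabolic J" "d' \<in> parabolic J"
    and "\<And>j. j \<in> J \<Longrightarrow> desc d j" "\<And>j. j \<in> J \<Longrightarrow> desc d' j"
  shows "d = d'"
proof -
  define x where "x = inv d \<otimes> d'"
  have c: "d \<in> carrier W" "d' \<in> carrier W" using assms parabolic_carrier by blast+
  have x: "x \<in> parabolic J" "inv x \<in> parabolic J"
    using assms by (auto simp: x_def intro!: parabolic_mult parabolic_inv)
  have xc: "x \<in> carrier W" using c by (simp add: x_def)
  have e: "d \<otimes> x = d'" "d' \<otimes> inv x = d"
    using c by (simp_all add: x_def inv_mult_group flip: m_assoc)
  have "len (d \<otimes> x) + len x = len d" by (rule len_parabolic_desc[OF c(1) assms(1) x(1) assms(4)])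
  moreover have "len (d' \<otimes> inv x) + len (inv x) = len d'"
    by (rule len_parabolic_desc[OF c(2) assms(1) x(2) assms(5)])
  ultimately have "len x = 0" using e xc by simp
  hence "x = \<one>" using xc len_eq_0 by blast
  thus ?thesis using e c by simp
qed

lemma parabolic_longest_factor:
  assumes J: "J \<subseteq> S" and h: "h \<in> carrier W" "\<And>j. j \<in> J \<Longrightarrow> desc h j"
  shows "\<exists>v\<in>carrier W. \<exists>d\<in>parabolic J. h = v \<otimes> d \<and> len h = len v + len d \<and> (\<forall>j\<in>J. desc d j)"
proof -
  obtain v d where v: "v \<in> carrier W" "d \<in> parabolic J" "h = v \<otimes> d" "\<forall>j\<in>J. \<not> desc v j"
    using parabolic_decomp[OF h(1) J] by blast
  obtain u where u: "u \<in> lists J" "ev u = d" using v(2) by (auto simp: parabolic_def)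
  have "desc d j" if "j \<in> J" for j
    using desc_parabolic_asc[OF v(1) J u(1) that] v h(2)[OF that] u by auto
  moreover have "len h = len v + len d"
    unfolding v(3) using v by (intro len_parabolic_asc[OF v(1) J v(2)]) auto
  ultimately show ?thesis using v by blast
qed

text \<open>The group may be infinite: a longest element of the parabolic subgroup is read off from
  \<open>h0\<close>, and its uniqueness makes it a common right factor of all elements with these
  descents.\<close>

lemma ex_parabolic_longest:
  assumes J: "J \<subseteq> S" and h0: "h0 \<in> carrier W" "\<And>j. j \<in> J \<Longrightarrow> desc h0 j"
  obtains d where "d \<in> carrier W" "\<And>j. j \<in> J \<Longrightarrow> desc d j"
    "\<And>h. h \<in> carrier W \<Longrightarrow> (\<And>j. j \<in> J \<Longrightarrow> desc h j) \<Longrightarrow>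
       \<exists>v\<in>carrier W. h = v \<otimes> d \<and> len h = len v + len d"
proof -
  obtain d where d: "d \<in> parabolic J" "\<forall>j\<in>J. desc d j"
    using parabolic_longest_factor[OF J h0] by blast
  show thesis
  proof (rule that[of d])
    show "d \<in> carrier W" using d J parabolic_carrier by blast
    show "desc d j" if "j \<in> J" for j using d that by blast
    fix h assume h: "h \<in> carrier W" "\<And>j. j \<in> J \<Longrightarrow> desc h j"
    obtain v d' where v: "v \<in> carrier W" "d' \<in> parabolic J" "h = v \<otimes> d'" "len h = len v + len d'"
      "\<forall>j\<in>J. desc d' j" using parabolic_longest_factor[OF J h] by blast
    have "d' = d" using parabolic_longest_unique[OF J v(2) d(1)] v(5) d(2) by blast
    thus "\<exists>v\<in>carrier W. h = v \<otimes> d \<and> len h = len v + len d" using v by blast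
  qed
qed

section \<open>Joins and meets in the left weak order\<close>

abbreviation lle :: "'a \<Rightarrow> 'a \<Rightarrow> bool" where "lle \<equiv> left_weak_le W S"
abbreviation rle :: "'a \<Rightarrow> 'a \<Rightarrow> bool" where "rle \<equiv> right_weak_le W S"

lemma lle_iff: "lle x y \<longleftrightarrow> len (y \<otimes> inv x) + len x = len y"
  unfolding left_weak_le_def by linarith

lemma rle_iff: "rle x y \<longleftrightarrow> len x + len (inv x \<otimes> y) = len y"
  unfolding right_weak_le_def by linarith

lemma lleI:
  assumes "a \<in> carrier W" "x \<in> carrier W" "len (a \<otimes> x) = len a + len x"
  shows "lle x (a \<otimes> x)"
  using assms by (simp add: lle_iff m_assoc)

lemma lleE:
  assumes "lle x y" "x \<in> carrier W" "y \<in> carrier W"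
  obtains a where "a \<in> carrier W" "y = a \<otimes> x" "len y = len a + len x"
  using that[of "y \<otimes> inv x"] assms by (simp add: lle_iff m_assoc)

lemma lle_refl [simp]: "x \<in> carrier W \<Longrightarrow> lle x x"
  by (simp add: lle_iff)

lemma lle_one [simp]: "x \<in> carrier W \<Longrightarrow> lle \<one> x"
  by (simp add: lle_iff)

lemma lle_len: "lle x y \<Longrightarrow> len x \<le> len y"
  by (simp add: lle_iff)

lemma lle_len_eq:
  assumes "lle x y" "len y \<le> len x" "x \<in> carrier W" "y \<in> carrier W"
  shows "x = y"
proof -
  obtain a where a: "a \<in> carrier W" "y = a \<otimes> x" "len y = len a + len x"
    using lleE assms by blast
  hence "a = \<one>" using assms(2) len_eq_0[of a] by simp
  thus ?thesis using a assms by simp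
qed

lemma lle_antisym: "lle x y \<Longrightarrow> lle y x \<Longrightarrow> x \<in> carrier W \<Longrightarrow> y \<in> carrier W \<Longrightarrow> x = y"
  using lle_len_eq lle_len by blast

lemma lle_trans:
  assumes "lle x y" "lle y z" "x \<in> carrier W" "y \<in> carrier W" "z \<in> carrier W"
  shows "lle x z"
proof -
  obtain a where a: "a \<in> carrier W" "y = a \<otimes> x" "len y = len a + len x"
    using lleE assms by blast
  obtain b where b: "b \<in> carrier W" "z = b \<otimes> y" "len z = len b + len y"
    using lleE assms by blast
  have e: "z = (b \<otimes> a) \<otimes> x" using a b assms by (simp add: m_assoc)
  have "len z = len (b \<otimes> a) + len x"
    using len_mult[of "b \<otimes> a" x] len_mult[of b a] a b e assms(3) by simp
  thus ?thesis using lleI[of "b \<otimes> a" x] a b e assms(3) by simp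
qed

definition is_join :: "'a \<Rightarrow> 'a \<Rightarrow> 'a \<Rightarrow> bool" where
  "is_join a b j \<longleftrightarrow> j \<in> carrier W \<and> lle a j \<and> lle b j \<and>
     (\<forall>y\<in>carrier W. lle a y \<longrightarrow> lle b y \<longrightarrow> lle j y)"

lemma upper_bound_cover:
  assumes "c \<in> carrier W" "s \<in> S" "len (s \<otimes> c) = len c + 1" "y \<in> carrier W" "lle (s \<otimes> c) y"
  shows "len y = len (y \<otimes> inv c) + len c" and "desc (y \<otimes> inv c) s"
proof -
  obtain a where a: "a \<in> carrier W" "y = a \<otimes> (s \<otimes> c)" "len y = len a + len (s \<otimes> c)"
    using lleE[of "s \<otimes> c" y] assms by auto
  have h: "y \<otimes> inv c = a \<otimes> s" using a assms by (simp add: m_assoc)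
  have "len y \<le> len (a \<otimes> s) + len c" using len_mult[of "a \<otimes> s" c] a assms by (simp add: m_assoc)
  moreover have "len (a \<otimes> s) \<le> len a + 1" by (rule len_mult_gen[OF a(1) assms(2)])
  ultimately show "len y = len (y \<otimes> inv c) + len c" "desc (y \<otimes> inv c) s"
    unfolding h using a assms by auto
qed

text \<open>For an upper bound \<open>y\<close>, \<open>y \<otimes> inv c\<close> has
  \<open>s\<close> and \<open>t\<close> as right descents, so it ends in the longest element
  \<open>d\<close> of their parabolic subgroup. Hence \<open>y\<close> lies above
  \<open>d \<otimes> c\<close>.\<close>

lemma join_of_covers:
  assumes c: "c \<in> carrier W" and st: "s \<in> S" "t \<in> S"
    and l: "len (s \<otimes> c) = len c + 1" "len (t \<otimes> c) = len c + 1"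
    and z: "z \<in> carrier W" "lle (s \<otimes> c) z" "lle (t \<otimes> c) z"
  shows "\<exists>j. is_join (s \<otimes> c) (t \<otimes> c) j"
proof -
  have h: "y \<otimes> inv c \<in> carrier W" "len y = len (y \<otimes> inv c) + len c"
      "\<And>i. i \<in> {s, t} \<Longrightarrow> desc (y \<otimes> inv c) i"
    if "y \<in> carrier W" "lle (s \<otimes> c) y" "lle (t \<otimes> c) y" for y
    using upper_bound_cover[OF c st(1) l(1) that(1,2)] upper_bound_cover[OF c st(2) l(2) that(1,3)]
      that c by auto
  obtain d where d: "d \<in> carrier W" "\<And>j. j \<in> {s, t} \<Longrightarrow> desc d j"
    "\<And>h. h \<in> carrier W \<Longrightarrow> (\<And>j. j \<in> {s, t} \<Longrightarrow> desc h j) \<Longrightarrow>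
       \<exists>v\<in>carrier W. h = v \<otimes> d \<and> len h = len v + len d"
    using ex_parabolic_longest[of "{s, t}" "z \<otimes> inv c"] h[OF z] st by blast
  have f: "\<exists>v\<in>carrier W. y = v \<otimes> (d \<otimes> c) \<and> len y = len v + len d + len c"
    if y: "y \<in> carrier W" "lle (s \<otimes> c) y" "lle (t \<otimes> c) y" for y
  proof -
    obtain v where v: "v \<in> carrier W" "y \<otimes> inv c = v \<otimes> d" "len (y \<otimes> inv c) = len v + len d"
      using d(3)[OF h(1,3)[OF y]] by blast
    have "y = y \<otimes> inv c \<otimes> c" using y c by (simp add: m_assoc)
    also have "\<dots> = v \<otimes> (d \<otimes> c)" unfolding v(2) using v d c by (simp add: m_assoc)
    finally show ?thesis using v h(2)[OF y] by auto
  qed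
  have ld: "len (d \<otimes> c) = len d + len c"
  proof -
    obtain v where "v \<in> carrier W" "z = v \<otimes> (d \<otimes> c)" "len z = len v + len d + len c"
      using f[OF z] by blast
    thus ?thesis using len_mult[of v "d \<otimes> c"] len_mult[of d c] d c by simp
  qed
  have lb: "lle (i \<otimes> c) (d \<otimes> c)" if i: "i \<in> S" "desc d i" "len (i \<otimes> c) = len c + 1" for i
  proof -
    have "d \<otimes> c = (d \<otimes> i) \<otimes> (i \<otimes> c)" using d c i by (simp add: m_assoc)
    moreover have "len (d \<otimes> c) = len (d \<otimes> i) + len (i \<otimes> c)"
      using ld descent_len[of d i] i d by simp
    ultimately show ?thesis using lleI[of "d \<otimes> i" "i \<otimes> c"] d c i by simp
  qed
  have "is_join (s \<otimes> c) (t \<otimes> c) (d \<otimes> c)"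
    unfolding is_join_def
  proof (intro conjI ballI impI)
    show "d \<otimes> c \<in> carrier W" using d c by simp
    show "lle (s \<otimes> c) (d \<otimes> c)" "lle (t \<otimes> c) (d \<otimes> c)" using lb d(2) st l by auto
    fix y assume "y \<in> carrier W" "lle (s \<otimes> c) y" "lle (t \<otimes> c) y"
    then obtain v where "v \<in> carrier W" "y = v \<otimes> (d \<otimes> c)" "len y = len v + len d + len c"
      using f by blast
    thus "lle (d \<otimes> c) y" using lleI[of v "d \<otimes> c"] ld d c by simp
  qed
  thus ?thesis ..
qed

lemma ex_cover_below:
  assumes "c \<in> carrier W" "a \<in> carrier W" "lle c a" "a \<noteq> c"
  shows "\<exists>s\<in>S. len (s \<otimes> c) = len c + 1 \<and> lle (s \<otimes> c) a"
proof -
  obtain x where x: "x \<in> carrier W" "a = x \<otimes> c" "len a = len x + len c" using lleE assms by blast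
  have "x \<noteq> \<one>" using x assms by auto
  then obtain s where s: "s \<in> S" "desc x s" using ex_descent x by blast
  have e: "a = (x \<otimes> s) \<otimes> (s \<otimes> c)" using x s assms by (simp add: m_assoc)
  have "len a \<le> len (x \<otimes> s) + len (s \<otimes> c)"
    using len_mult[of "x \<otimes> s" "s \<otimes> c"] x s assms unfolding e by simp
  moreover have "len x = len (x \<otimes> s) + 1" using descent_len x s by blast
  moreover have "len (s \<otimes> c) \<le> 1 + len c" using len_mult[of s c] s assms by simp
  ultimately have l: "len (s \<otimes> c) = len c + 1" "len a = len (x \<otimes> s) + len (s \<otimes> c)" using x by auto
  thus ?thesis using lleI[of "x \<otimes> s" "s \<otimes> c"] s x e assms by auto
qed

text \<open>Joins of bounded pairs are built from joins of two covers of a common element, by induction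
  on the height of the interval (Bjoerner, Edelman and Ziegler).\<close>

lemma ex_join:
  assumes "c \<in> carrier W" "a \<in> carrier W" "b \<in> carrier W" "z \<in> carrier W"
    and "lle c a" "lle c b" "lle a z" "lle b z"
  shows "\<exists>j. is_join a b j"
  using assms
proof (induction "len z - len c" arbitrary: c a b rule: less_induct)
  case less
  note p = less.prems
  show ?case
  proof (cases "a = c \<or> b = c")
    case True
    hence "is_join a b b \<or> is_join a b a" using p by (auto simp: is_join_def)
    thus ?thesis by blast
  next
    case False
    obtain s where s: "s \<in> S" "len (s \<otimes> c) = len c + 1" "lle (s \<otimes> c) a"
      using ex_cover_below[of c a] p False by blast
    obtain t where t: "t \<in> S" "len (t \<otimes> c) = len c + 1" "lle (t \<otimes> c) b"
      using ex_cover_below[of c b] p False by blast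
    have sc: "s \<otimes> c \<in> carrier W" "t \<otimes> c \<in> carrier W" using s t p by auto
    have z: "lle (s \<otimes> c) z" "lle (t \<otimes> c) z" using lle_trans s t p sc by blast+
    have hyp: "len z - len (s \<otimes> c) < len z - len c" "len z - len (t \<otimes> c) < len z - len c"
      using s(2) t(2) lle_len[OF z(1)] lle_len[OF z(2)] by linarith+
    obtain j where j: "is_join (s \<otimes> c) (t \<otimes> c) j"
      using join_of_covers[OF p(1) s(1) t(1) s(2) t(2) p(4) z] by blast
    have jz: "j \<in> carrier W" "lle j z" "lle (s \<otimes> c) j" "lle (t \<otimes> c) j"
      using j z p by (auto simp: is_join_def)
    \<comment> \<open>Joining \<open>a\<close> with \<open>j\<close> happens above
      \<open>s \<otimes> c\<close>, joining the result with \<open>b\<close> above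
      \<open>t \<otimes> c\<close>; both intervals up to \<open>z\<close> are shorter than the one
      from \<open>c\<close>.\<close>
    obtain d where d: "is_join a j d"
      using less.hyps[OF hyp(1) sc(1) p(2) jz(1) p(4) s(3) jz(3) p(7) jz(2)] by blast
    have dz: "d \<in> carrier W" "lle d z" "lle j d" "lle a d" using d jz p by (auto simp: is_join_def)
    have "lle (t \<otimes> c) d" using lle_trans[OF jz(4) dz(3) sc(2) jz(1) dz(1)] .
    then obtain e where e: "is_join d b e"
      using less.hyps[OF hyp(2) sc(2) dz(1) p(3) p(4) _ t(3) dz(2) p(8)] by blast
    have "is_join a b e"
      unfolding is_join_def
    proof (intro conjI ballI impI)
      show ec: "e \<in> carrier W" and "lle b e" using e by (auto simp: is_join_def)
      have "lle d e" using e by (auto simp: is_join_def)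
      thus "lle a e" using lle_trans[OF dz(4) _ p(2) dz(1) ec] by blast
      fix y assume y: "y \<in> carrier W" "lle a y" "lle b y"
      have "lle (s \<otimes> c) y" "lle (t \<otimes> c) y"
        using lle_trans[OF s(3) y(2) sc(1) p(2) y(1)] lle_trans[OF t(3) y(3) sc(2) p(3) y(1)] by auto
      hence "lle j y" using j y by (auto simp: is_join_def)
      hence "lle d y" using d y by (auto simp: is_join_def)
      thus "lle e y" using e y by (auto simp: is_join_def)
    qed
    thus ?thesis ..
  qed
qed

text \<open>A longest common lower bound is the greatest: its join with any other one exists, as
  both lie below \<open>x\<close>, and is again a common lower bound, hence no longer.\<close>

lemma ex_meet:
  assumes "x \<in> carrier W" "y \<in> carrier W"
  shows "\<exists>g\<in>carrier W. lle g x \<and> lle g y \<and> (\<forall>u\<in>carrier W. lle u x \<longrightarrow> lle u y \<longrightarrow> lle u g)"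
proof -
  define L where "L = {u \<in> carrier W. lle u x \<and> lle u y}"
  have "\<one> \<in> L" using assms by (simp add: L_def)
  moreover have "\<forall>u. u \<in> L \<longrightarrow> len u < Suc (len x)" by (auto simp: L_def dest: lle_len)
  ultimately obtain g where g: "g \<in> L" "\<And>u. u \<in> L \<Longrightarrow> len u \<le> len g"
    using ex_has_greatest_nat[of "\<lambda>u. u \<in> L" \<one> len "Suc (len x)"] by auto
  have "lle u g" if u: "u \<in> L" for u
  proof -
    obtain j where j: "is_join u g j"
      using ex_join[of \<one> u g x] u g(1) assms by (auto simp: L_def)
    hence "j \<in> L" using u g(1) assms by (auto simp: is_join_def L_def)
    hence "len j \<le> len g" using g by blast
    hence "g = j" using lle_len_eq[of g j] j g(1) by (auto simp: is_join_def L_def)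
    thus ?thesis using j by (auto simp: is_join_def)
  qed
  thus ?thesis using g(1) by (auto simp: L_def)
qed

abbreviation meetL :: "'a \<Rightarrow> 'a \<Rightarrow> 'a" where
  "meetL x y \<equiv> x \<sqinter>\<^bsub>left_weak_order W S\<^esub> y"

text \<open>The lattice operation chooses some greatest lower bound, so its properties follow once
  one exists.\<close>

lemma meetL:
  assumes "x \<in> carrier W" "y \<in> carrier W"
  shows "meetL x y \<in> carrier W" "lle (meetL x y) x" "lle (meetL x y) y"
    "\<And>u. u \<in> carrier W \<Longrightarrow> lle u x \<Longrightarrow> lle u y \<Longrightarrow> lle u (meetL x y)"
proof -
  let ?L = "left_weak_order W S"
  have eq: "greatest ?L g (Lower ?L {x, y}) \<longleftrightarrow> g \<in> carrier W \<and> lle g x \<and> lle g y \<and>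
      (\<forall>u\<in>carrier W. lle u x \<longrightarrow> lle u y \<longrightarrow> lle u g)" for g
    using assms by (auto simp: greatest_def Lower_def left_weak_order_def)
  have "\<exists>g. greatest ?L g (Lower ?L {x, y})" unfolding eq using ex_meet[OF assms] by blast
  hence "greatest ?L (meetL x y) (Lower ?L {x, y})"
    unfolding meet_def inf_def by (rule someI_ex)
  thus "meetL x y \<in> carrier W" "lle (meetL x y) x" "lle (meetL x y) y"
    "\<And>u. u \<in> carrier W \<Longrightarrow> lle u x \<Longrightarrow> lle u y \<Longrightarrow> lle u (meetL x y)"
    unfolding eq by blast+
qed

lemma meetL_absorb: "x \<in> carrier W \<Longrightarrow> y \<in> carrier W \<Longrightarrow> lle x y \<Longrightarrow> meetL x y = x"
  using meetL[of x y] by (intro lle_antisym) auto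

section \<open>Semilattice congruences and minimal elements of classes\<close>

context
  fixes r :: "'a rel"
  assumes cong: "semilattice_congruence W S r"
begin

lemma r_equiv: "equiv (carrier W) r"
  using cong by (simp add: semilattice_congruence_def)

lemma r_carrier: "(x, y) \<in> r \<Longrightarrow> x \<in> carrier W \<and> y \<in> carrier W"
  using r_equiv by (auto simp: equiv_def refl_on_def)

lemma r_sym: "(x, y) \<in> r \<Longrightarrow> (y, x) \<in> r"
  using r_equiv by (auto simp: equiv_def sym_def)

lemma r_trans: "(x, y) \<in> r \<Longrightarrow> (y, z) \<in> r \<Longrightarrow> (x, z) \<in> r"
  using r_equiv by (meson equiv_def transD)

lemma r_refl: "x \<in> carrier W \<Longrightarrow> (x, x) \<in> r"
  using r_equiv by (auto simp: equiv_def refl_on_def)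

lemma r_meet: "(x1, x2) \<in> r \<Longrightarrow> (y1, y2) \<in> r \<Longrightarrow> (meetL x1 y1, meetL x2 y2) \<in> r"
  using cong by (simp add: semilattice_congruence_def)

text \<open>The meet of a class member with a shortest member \<open>v\<close> stays in the class
  and cannot be shorter than \<open>v\<close>, so \<open>v\<close> lies below the whole class. Thus
  the minimal element is unique and the definite description denotes \<open>v\<close>.\<close>

lemma proj_down:
  assumes w: "w \<in> carrier W"
  shows "(w, proj_down W S r w) \<in> r" and "lle (proj_down W S r w) w"
proof -
  obtain v where v: "(w, v) \<in> r" "\<And>u. (w, u) \<in> r \<Longrightarrow> len v \<le> len u"
    using ex_has_least_nat[of "\<lambda>v. (w, v) \<in> r" w len] r_refl[OF w] by blast
  have vc: "v \<in> carrier W" using v r_carrier by blast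
  have least: "lle v u" if u: "(w, u) \<in> r" for u
  proof -
    have uc: "u \<in> carrier W" using u r_carrier by blast
    have "(meetL w w, meetL u v) \<in> r" using r_meet u v(1) by blast
    hence "(w, meetL u v) \<in> r" using meetL_absorb[of w w] w by simp
    hence "meetL u v = v" using v(2) meetL[OF uc vc] vc by (intro lle_len_eq) auto
    thus ?thesis using meetL(2)[OF uc vc] by simp
  qed
  have "proj_down W S r w = v"
    unfolding proj_down_def
  proof (rule the_equality)
    show "v \<in> r `` {w} \<and> (\<forall>u\<in>r `` {w}. lle u v \<longrightarrow> u = v)"
      using v least r_carrier vc by (auto intro: lle_antisym)
    show "v' = v" if "v' \<in> r `` {w} \<and> (\<forall>u\<in>r `` {w}. lle u v' \<longrightarrow> u = v')" for v'
      using that v least by auto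
  qed
  thus "(w, proj_down W S r w) \<in> r" "lle (proj_down W S r w) w"
    using v(1) least r_refl[OF w] by auto
qed

lemma desc_iff_lle:
  assumes "w \<in> carrier W" "s \<in> S"
  shows "desc w s \<longleftrightarrow> lle s w"
  using assms descent_len[of w s] by (auto simp: lle_iff)

lemma desc_proj_down:
  assumes ess: "essential W r" and w: "w \<in> carrier W" and s: "s \<in> S" "desc w s"
  shows "desc (proj_down W S r w) s"
proof -
  define p where "p = proj_down W S r w"
  have p: "(w, p) \<in> r" "p \<in> carrier W" using proj_down(1)[OF w] r_carrier by (auto simp: p_def)
  have "(meetL s w, meetL s p) \<in> r" using r_meet r_refl p s by auto
  hence sp: "(s, meetL s p) \<in> r" using meetL_absorb[of s w] s w desc_iff_lle by simp
  have "meetL s p \<noteq> \<one>"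
  proof
    assume "meetL s p = \<one>"
    hence s1: "(s, \<one>) \<in> r" using sp by simp
    obtain x where x: "{\<one>} = r `` {x}" using ess by (auto simp: essential_def elim: quotientE)
    hence "(x, \<one>) \<in> r" by auto
    hence "(x, s) \<in> r" using s1 r_sym r_trans by blast
    hence "s = \<one>" using x by auto
    thus False using len_gen_eq[OF s(1)] by simp
  qed
  hence "len (meetL s p) \<noteq> 0" using len_eq_0 meetL(1)[of s p] s p by simp
  hence "meetL s p = s" using meetL[of s p] s p by (intro lle_len_eq) auto
  hence "lle s p" using meetL(3)[of s p] s p by simp
  thus ?thesis using desc_iff_lle p s by (simp add: p_def)
qed

lemma compulsive_stack_sort:
  assumes ess: "essential W r"
  shows "compulsive W S (stack_sort W S r)"
  unfolding compulsive_def
proof (intro conjI ballI funcsetI)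
  fix w assume w: "w \<in> carrier W"
  define p where "p = proj_down W S r w"
  have p: "p \<in> carrier W" "lle p w"
    using proj_down[OF w] r_carrier by (auto simp: p_def)
  have f: "stack_sort W S r w = w \<otimes> inv p" by (simp add: stack_sort_def p_def)
  show "stack_sort W S r w \<in> carrier W" using f w p by simp
  \<comment> \<open>The quotient of \<open>w\<close> by its image is \<open>p\<close>, and that of
    \<open>w \<otimes> s\<close> is \<open>p \<otimes> s\<close>. Both products with
    \<open>s\<close> are one shorter, so additivity of lengths carries over from \<open>w\<close> to
    \<open>w \<otimes> s\<close>.\<close>
  have 1: "inv (w \<otimes> inv p) \<otimes> w = p" using w p by (simp add: inv_mult_group m_assoc)
  have l: "len (w \<otimes> inv p) + len p = len w" using p by (simp add: lle_iff)
  show "rle (stack_sort W S r w) w" unfolding rle_iff f 1 by (rule l)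
  fix s assume "s \<in> right_descents W S w"
  hence s: "s \<in> S" "desc w s" by (auto simp: right_descents_def)
  have "desc p s" using desc_proj_down[OF ess w s] by (simp add: p_def)
  hence "len p = len (p \<otimes> s) + 1" using descent_len p s by blast
  moreover have "len w = len (w \<otimes> s) + 1" using descent_len w s by blast
  moreover have "inv (w \<otimes> inv p) \<otimes> (w \<otimes> s) = p \<otimes> s"
  proof -
    have "inv (w \<otimes> inv p) \<otimes> (w \<otimes> s) = (inv (w \<otimes> inv p) \<otimes> w) \<otimes> s"
      using w p s by (simp add: m_assoc)
    thus ?thesis unfolding 1 .
  qed
  ultimately show "rle (stack_sort W S r w) (w \<otimes> s)" unfolding rle_iff f using l by simp
qed

end

end


section \<open>Iterating compulsive maps\<close>

lemma subseq_delete_nth: "subseq (take i v @ drop (Suc i) v) v"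
proof -
  have "subseq (drop (Suc i) v) (drop i v)"
    using suffix_drop[of 1 "drop i v"] by (intro suffix_imp_subseq) (simp add: add.commute)
  hence "subseq (take i v @ drop (Suc i) v) (take i v @ drop i v)" by (intro list_emb_append_mono) auto
  thus ?thesis by simp
qed

lemma subseq_snoc_cases:
  assumes "subseq v (u @ [s])"
  shows "subseq v u \<or> (\<exists>v'. v = v' @ [s] \<and> subseq v' u)"
proof -
  obtain a b where ab: "v = a @ b" "subseq a u" "subseq b [s]"
    using assms unfolding subseq_append_iff by blast
  from ab(3) have "b = [] \<or> b = [s]" by (cases b) (auto split: if_splits)
  thus ?thesis using ab by auto
qed

lemma subseq_set_mono: "subseq v u \<Longrightarrow> set v \<subseteq> set u"
  by (auto simp: subseq_conv_nths dest: in_set_nthsD)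

fun alt :: "nat \<Rightarrow> 'a list \<Rightarrow> 'a list \<Rightarrow> 'a list" where
  "alt 0 xs ys = []"
| "alt (Suc k) xs ys = xs @ alt k ys xs"

lemma alt_add: "alt (i + j) xs ys = alt i xs ys @ (if even i then alt j xs ys else alt j ys xs)"
  by (induction i arbitrary: xs ys) auto

lemma alt_snoc: "alt (Suc k) xs ys = alt k xs ys @ (if even k then xs else ys)"
  using alt_add[of k 1 xs ys] by simp

context coxeter_system
begin

text \<open>For a reduced word this is the lower Bruhat interval of its product, by the subword
  property. Allowing all subwords of all words avoids setting up the Bruhat order.\<close>

definition subs :: "'a list \<Rightarrow> 'a set" where
  "subs u = ev ` {v. subseq v u}"

lemma subseq_lists: "subseq v u \<Longrightarrow> u \<in> lists A \<Longrightarrow> v \<in> lists A"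
  by (auto simp: in_lists_conv_set dest: subseq_set_mono)

lemma subs_mem: "u \<in> lists S \<Longrightarrow> ev u \<in> subs u"
  by (auto simp: subs_def)

lemma subs_carrier: "u \<in> lists S \<Longrightarrow> a \<in> subs u \<Longrightarrow> a \<in> carrier W"
  by (auto simp: subs_def dest: subseq_lists)

lemma subs_descent:
  assumes "u \<in> lists S" "a \<in> subs u" "s \<in> S" "desc a s"
  shows "a \<otimes> s \<in> subs u"
proof -
  obtain v where v: "subseq v u" "a = ev v" using assms(2) by (auto simp: subs_def)
  have "v \<in> lists S" using v assms(1) subseq_lists by blast
  then obtain i where "a \<otimes> s = ev (take i v @ drop (Suc i) v)"
    using exchange[of v s] assms(3,4) v by blast
  moreover have "subseq (take i v @ drop (Suc i) v) u"
    using subseq_delete_nth v(1) by (rule subseq_order.order_trans)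
  ultimately show ?thesis by (auto simp: subs_def)
qed

text \<open>If the subword uses the last \<open>s\<close> although \<open>s\<close> is not a descent
  of \<open>w\<close>, then \<open>s\<close> is a descent of the product of the earlier letters, and
  exchange reaches \<open>w\<close> by deleting one of those instead.\<close>

lemma subs_snoc:
  assumes "u \<in> lists S" "s \<in> S" "w \<in> subs (u @ [s])"
  shows "(if desc w s then w \<otimes> s else w) \<in> subs u"
proof -
  obtain v where v: "subseq v (u @ [s])" "w = ev v" using assms(3) by (auto simp: subs_def)
  have wc: "w \<in> carrier W" using subs_carrier[of "u @ [s]"] assms by simp
  consider "subseq v u" | v' where "v = v' @ [s]" "subseq v' u" using subseq_snoc_cases[OF v(1)] by blast
  thus ?thesis
  proof cases
    case 1
    hence "w \<in> subs u" using v by (auto simp: subs_def)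
    thus ?thesis using subs_descent[OF assms(1) _ assms(2)] by auto
  next
    case 2
    have v'S: "v' \<in> lists S" using 2 assms(1) subseq_lists by blast
    have a: "ev v' \<in> subs u" using 2 by (auto simp: subs_def)
    have w: "w = ev v' \<otimes> s" using v 2 v'S assms(2) by simp
    hence ws: "w \<otimes> s = ev v'" using v'S assms(2) by simp
    show ?thesis
    proof (cases "desc w s")
      case True
      thus ?thesis using a ws by simp
    next
      case False
      hence "desc (ev v') s" using ascent_len[OF wc assms(2)] ws w by simp
      thus ?thesis using subs_descent[OF assms(1) a assms(2)] w False by simp
    qed
  qed
qed

lemma subs_rle:
  assumes "u \<in> lists S" "w \<in> subs u" "g \<in> carrier W" "rle g w"
  shows "g \<in> subs u"
  using assms(2,4)
proof (induction "len w" arbitrary: w rule: less_induct)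
  case less
  have w: "w \<in> carrier W" using subs_carrier assms(1) less.prems by blast
  define h where "h = inv g \<otimes> w"
  have h: "h \<in> carrier W" "len g + len h = len w" "w = g \<otimes> h"
    using less.prems w assms(3) by (simp_all add: h_def rle_iff flip: m_assoc)
  show ?case
  proof (cases "h = \<one>")
    case True
    thus ?thesis using h assms(3) less.prems by simp
  next
    case False
    then obtain s where s: "s \<in> S" "desc h s" using ex_descent h by blast
    have ws: "w \<otimes> s = g \<otimes> (h \<otimes> s)" using h assms(3) s by (simp add: m_assoc)
    have i: "inv g \<otimes> (w \<otimes> s) = h \<otimes> s" using w s assms(3) by (simp add: h_def m_assoc)
    have l: "len h = len (h \<otimes> s) + 1" using descent_len h s by blast
    have "len (w \<otimes> s) \<le> len g + len (h \<otimes> s)"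
      unfolding ws using h assms(3) s by (intro len_mult) auto
    moreover have "len w \<le> len (w \<otimes> s) + 1" using len_mult_gen_ge w s by blast
    ultimately have lw: "len (w \<otimes> s) + 1 = len w" "len g + len (h \<otimes> s) = len (w \<otimes> s)"
      using h(2) l by linarith+
    have "rle g (w \<otimes> s)" unfolding rle_iff i by (rule lw(2))
    moreover have "w \<otimes> s \<in> subs u"
      using subs_descent[OF assms(1) less.prems(1) s(1)] lw by simp
    ultimately show ?thesis using less.hyps[of "w \<otimes> s"] lw by simp
  qed
qed

lemma desc_commute:
  assumes "w \<in> carrier W" "s \<in> S" "t \<in> S" "s \<otimes> t = t \<otimes> s" "desc w s" "desc (w \<otimes> s) t"
  shows "desc w t"
proof (rule ccontr)
  assume "\<not> desc w t"
  hence "len (w \<otimes> t) = len w + 1" using ascent_len assms by blast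
  moreover have "w \<otimes> s \<otimes> t = w \<otimes> t \<otimes> s" using assms by (simp add: m_assoc)
  ultimately have "len w + 1 \<le> len (w \<otimes> s \<otimes> t) + 1"
    using len_mult_gen_ge[of "w \<otimes> t" s] assms by simp
  thus False using assms(5,6) by simp
qed

lemma desc_commute_both:
  assumes "w \<in> carrier W" "s \<in> S" "t \<in> S" "s \<noteq> t" "\<not> 3 \<le> m s t" "desc w s" "desc w t"
  shows "desc (w \<otimes> s) t"
proof -
  obtain u where u: "u \<in> lists S" "ev u = w" using ex_word assms by blast
  let ?z = "\<lambda>_. 1 :: real"
  have "zact ?z (u @ [s]) t = zact ?z u t" using bond_eq_0[OF assms(2-5)] by (simp add: fire_def)
  thus ?thesis using desc_iff_zact_neg[of u ?z t] desc_iff_zact_neg[of "u @ [s]" ?z t] u assms by simp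
qed

definition commuting :: "'a list \<Rightarrow> bool" where
  "commuting B \<longleftrightarrow> B \<in> lists S \<and> (\<forall>s\<in>set B. \<forall>t\<in>set B. \<not> 3 \<le> m s t)"

text \<open>As \<open>g\<close> stays below \<open>w \<otimes> s\<close> and
  \<open>w \<otimes> t\<close>, both letters are descents of \<open>inv g \<otimes> w\<close>.
  Commuting descents can be removed one after the other, so this element and \<open>w\<close> both
  lose length 2.\<close>

lemma rle_two_descents:
  assumes "g \<in> carrier W" "w \<in> carrier W" "s \<in> S" "t \<in> S" "s \<noteq> t" "\<not> 3 \<le> m s t"
    and "desc w s" "desc w t" "rle g w" "rle g (w \<otimes> s)" "rle g (w \<otimes> t)"
  shows "rle g (w \<otimes> s \<otimes> t)"
proof -
  define h where "h = inv g \<otimes> w"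
  have h: "h \<in> carrier W" "len g + len h = len w"
    using assms by (simp_all add: h_def rle_iff)
  have hi: "inv g \<otimes> (w \<otimes> i) = h \<otimes> i" if "i \<in> S" for i
    using assms that by (simp add: h_def m_assoc)
  have l: "len w = len (w \<otimes> s) + 1" "len w = len (w \<otimes> t) + 1"
    using assms descent_len by blast+
  have "desc h s" "desc h t"
    using assms(10,11) l h unfolding rle_iff hi[OF assms(3)] hi[OF assms(4)] by linarith+
  moreover from this have "desc (h \<otimes> s) t" using desc_commute_both h assms by blast
  ultimately have "len h = len (h \<otimes> s \<otimes> t) + 2"
    using descent_len[of h s] descent_len[of "h \<otimes> s" t] h assms(3,4) by simp
  moreover have "desc (w \<otimes> s) t" using desc_commute_both assms by blast
  hence "len w = len (w \<otimes> s \<otimes> t) + 2"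
    using descent_len[of "w \<otimes> s" t] l assms(2,3,4) by simp
  moreover have "inv g \<otimes> (w \<otimes> s \<otimes> t) = h \<otimes> s \<otimes> t"
    using assms by (simp add: h_def m_assoc)
  ultimately show ?thesis unfolding rle_iff using h by simp
qed

text \<open>Stripping a block of commuting letters from a word removes all right descents lying in that
  block, and a compulsive map does at least this much.\<close>

lemma subs_block:
  assumes "q \<in> lists S" "commuting B" "distinct B" "w \<in> subs (q @ B)" "g \<in> carrier W" "rle g w"
    and "\<And>s. s \<in> set B \<Longrightarrow> desc w s \<Longrightarrow> rle g (w \<otimes> s)"
  shows "g \<in> subs q"
  using assms(2-)
proof (induction B arbitrary: w rule: rev_induct)
  case Nil
  thus ?case using subs_rle[OF assms(1)] by simp
next
  case (snoc s B)
  have B: "B \<in> lists S" "s \<in> S" "commuting B" and ncom: "\<And>t. t \<in> set B \<Longrightarrow> \<not> 3 \<le> m s t"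
    using snoc.prems(1) by (auto simp: commuting_def)
  have neq: "t \<noteq> s" if "t \<in> set B" for t using snoc.prems(2) that by auto
  have BS: "t \<in> S" if "t \<in> set B" for t using B(1) that by (auto simp: in_lists_conv_set)
  have w: "w \<in> carrier W"
    using subs_carrier[of "q @ B @ [s]" w] snoc.prems(3) B assms(1) by simp
  have dist: "distinct B" using snoc.prems(2) by simp
  have sub: "(if desc w s then w \<otimes> s else w) \<in> subs (q @ B)"
    using subs_snoc[of "q @ B" s w] snoc.prems(3) B assms(1) by simp
  show ?case
  proof (cases "desc w s")
    case False
    show ?thesis
    proof (rule snoc.IH[OF B(3) dist _ snoc.prems(4)])
      show "w \<in> subs (q @ B)" using sub False by simp
      show "rle g w" by (rule snoc.prems(5))
      show "rle g (w \<otimes> t)" if "t \<in> set B" "desc w t" for t using snoc.prems(6) that by simp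
    qed
  next
    case True
    show ?thesis
    proof (rule snoc.IH[OF B(3) dist _ snoc.prems(4)])
      show "w \<otimes> s \<in> subs (q @ B)" using sub True by simp
      show gws: "rle g (w \<otimes> s)" using snoc.prems(6) True by simp
      fix t assume t: "t \<in> set B" "desc (w \<otimes> s) t"
      have tS: "t \<in> S" using BS t by blast
      \<comment> \<open>Removing \<open>s\<close> creates no new descent in the block, so the
        hypothesis on \<open>g\<close> applies to \<open>t\<close>.\<close>
      have "desc w t"
        using desc_commute[OF w B(2) tS gens_commute[OF B(2) tS ncom[OF t(1)]] True t(2)] .
      moreover from this have "rle g (w \<otimes> t)" using snoc.prems(6) t(1) by simp
      ultimately show "rle g (w \<otimes> s \<otimes> t)"
        using rle_two_descents[OF snoc.prems(4) w B(2) tS _ ncom[OF t(1)] True] neq[OF t(1)]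
          snoc.prems(5) gws by blast
    qed
  qed
qed

lemma compulsive_subs:
  assumes "compulsive W S f" "q \<in> lists S" "commuting B" "distinct B" "w \<in> subs (q @ B)"
  shows "f w \<in> subs q"
proof -
  have w: "w \<in> carrier W"
    using subs_carrier[of "q @ B" w] assms by (auto simp: commuting_def)
  show ?thesis
    using assms w by (intro subs_block[OF assms(2-5)])
      (auto simp: compulsive_def right_descents_def commuting_def in_lists_conv_set)
qed

lemma alt_lists: "xs \<in> lists S \<Longrightarrow> ys \<in> lists S \<Longrightarrow> alt k xs ys \<in> lists S"
  by (induction k arbitrary: xs ys) auto

lemma compulsive_iterate_subs:
  assumes "compulsive W S f" "commuting xs" "commuting ys" "distinct xs" "distinct ys"
    and "w \<in> subs (alt (k + j) xs ys)"
  shows "(f ^^ k) w \<in> subs (alt j xs ys)"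
  using assms(6)
proof (induction k arbitrary: j)
  case (Suc k)
  hence 1: "(f ^^ k) w \<in> subs (alt (Suc j) xs ys)" by (metis add_Suc_shift)
  have "xs \<in> lists S" "ys \<in> lists S" using assms by (auto simp: commuting_def)
  thus ?case using compulsive_subs[OF assms(1) alt_lists _ _ 1[unfolded alt_snoc]] assms(2-5)
    by (cases "even j") auto
qed simp

lemma compulsive_one:
  assumes "compulsive W S f"
  shows "f \<one> = \<one>"
proof -
  have "f \<one> \<in> carrier W" "rle (f \<one>) \<one>" using assms by (auto simp: compulsive_def)
  thus ?thesis by (simp add: rle_iff len_eq_0)
qed

section \<open>Parabolic subgroups of disjoint sets of generators\<close>

lemma reduced_snoc:
  assumes "v \<in> lists S" "t \<in> S" "length (v @ [t]) = len (ev (v @ [t]))"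
  shows "length v = len (ev v)" and "\<not> desc (ev v) t"
proof -
  have "Suc (length v) = len (ev v \<otimes> t)" using assms by simp
  thus "length v = len (ev v)" "\<not> desc (ev v) t"
    using len_mult_gen[of "ev v" t] len_ev_le[OF assms(1)] assms by auto
qed

text \<open>Along a reduced word only positive values are fired, so the values at other vertices
  never decrease. Hence a generator missing from a reduced word is not a descent of its
  product.\<close>

lemma zact_reduced_ge:
  assumes "v \<in> lists S" "length v = len (ev v)" "\<And>t. t \<in> S \<Longrightarrow> z t > 0" "s \<in> S" "s \<notin> set v"
  shows "zact z v s \<ge> z s"
  using assms(1,2,5)
proof (induction v rule: rev_induct)
  case (snoc t v)
  have t: "v \<in> lists S" "t \<in> S" "t \<noteq> s" "s \<notin> set v" using snoc.prems by auto
  note r = reduced_snoc[OF t(1,2) snoc.prems(2)]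
  have "zact z v t > 0" using zact_pos[OF t(1) assms(3) t(2) r(2)] .
  moreover have "bond t s \<ge> 0" using bond_nonneg t assms(4) by blast
  ultimately have "bond t s * zact z v t \<ge> 0" by simp
  thus ?case using snoc.IH[OF t(1) r(1) t(4)] by (simp add: fire_def)
qed simp

lemma parabolic_desc_mem:
  assumes "J \<subseteq> S" "d \<in> parabolic J" "s \<in> S" "desc d s"
  shows "s \<in> J"
proof (rule ccontr)
  assume "s \<notin> J"
  obtain v where v: "v \<in> lists J" "ev v = d" "length v = len d"
    using parabolic_reduced_word[OF assms(1,2)] by blast
  have vS: "v \<in> lists S" using v assms(1) lists_subsetD by blast
  have "s \<notin> set v" using v(1) \<open>s \<notin> J\<close> by (auto simp: in_lists_conv_set)
  hence "zact (\<lambda>_. 1) v s \<ge> 1" using zact_reduced_ge[OF vS _ _ assms(3), of "\<lambda>_. 1"] v by simp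
  moreover have "zact (\<lambda>_. 1) v s < 0" using zact_neg[OF vS _ assms(3)] assms(4) v by simp
  ultimately show False by simp
qed

lemma parabolic_disjoint:
  assumes "J \<subseteq> S" "K \<subseteq> S" "J \<inter> K = {}" "g \<in> parabolic J" "g \<in> parabolic K"
  shows "g = \<one>"
proof (rule ccontr)
  assume "g \<noteq> \<one>"
  then obtain s where "s \<in> S" "desc g s"
    using ex_descent parabolic_carrier[OF assms(1,4)] by blast
  thus False using parabolic_desc_mem assms by blast
qed

lemma subs_parabolic: "subs u \<subseteq> parabolic (set u)"
  using subseq_set_mono by (fastforce simp: subs_def parabolic_def in_lists_conv_set)

end


section \<open>Perron vectors and forests\<close>

lemma le_all_pos_multiples:
  fixes c d :: real
  assumes "\<And>\<epsilon>. \<epsilon> > 0 \<Longrightarrow> c \<le> \<epsilon> * d"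
  shows "c \<le> 0"
proof (rule ccontr)
  assume "\<not> c \<le> 0"
  hence c: "c > 0" by simp
  have "c \<le> (c / (2 * (\<bar>d\<bar> + 1))) * d" by (rule assms) (use c in auto)
  also have "\<dots> \<le> (c / (2 * (\<bar>d\<bar> + 1))) * (\<bar>d\<bar> + 1)" using c by (intro mult_left_mono) auto
  also have "\<dots> = c / 2" by (simp add: field_simps add_pos_nonneg)
  finally show False using c by simp
qed

text \<open>The maximum of the Rayleigh quotient over nonnegative vectors is attained at an eigenvector;
  no differentiation is needed, since the coordinate directions with \<open>\<epsilon> > 0\<close> stay nonnegative.\<close>

theorem perron_symmetric:
  fixes M :: "'i \<Rightarrow> 'i \<Rightarrow> real"
  assumes S: "finite S" "S \<noteq> {}"
    and sym: "\<And>s t. s \<in> S \<Longrightarrow> t \<in> S \<Longrightarrow> M s t = M t s"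
    and nonneg: "\<And>s t. s \<in> S \<Longrightarrow> t \<in> S \<Longrightarrow> M s t \<ge> 0"
    and irr: "\<And>A. A \<subseteq> S \<Longrightarrow> A \<noteq> {} \<Longrightarrow> A \<noteq> S \<Longrightarrow> \<exists>s\<in>A. \<exists>t\<in>S - A. M s t > 0"
  shows "\<exists>x l. (\<forall>s\<in>S. x s > 0) \<and> (\<forall>s\<in>S. (\<Sum>t\<in>S. M s t * x t) = l * x s)"
proof -
  define Q where "Q x = (\<Sum>s\<in>S. \<Sum>t\<in>S. M s t * x s * x t)" for x :: "'i \<Rightarrow> real"
  define N where "N x = (\<Sum>s\<in>S. (x s)\<^sup>2)" for x :: "'i \<Rightarrow> real"
  \<comment> \<open>Coordinates outside \<open>S\<close> are pinned to 0, so that the box is compact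
    in the product topology on all functions and \<open>N\<close> and \<open>Q\<close> see every
    free coordinate.\<close>
  define P where "P = Pi\<^sub>E UNIV (\<lambda>i. if i \<in> S then {0..1::real} else {0})"
  define K where "K = P \<inter> {x. N x = 1}"
  have "compactin (product_topology (\<lambda>_. euclidean) UNIV) P"
    unfolding P_def compactin_PiE by auto
  hence "compact P" by (simp add: euclidean_product_topology)
  moreover have cont: "continuous_on UNIV (\<lambda>x :: 'i \<Rightarrow> real. x s)" for s
    by (rule continuous_on_product_coordinates)
  have "continuous_on UNIV N" unfolding N_def by (intro continuous_intros cont)
  hence "closed {x. N x = 1}" by (intro closed_Collect_eq) (auto intro: continuous_intros)
  ultimately have "compact K" unfolding K_def by (rule compact_Int_closed)
  moreover have "K \<noteq> {}"
  proof -
    obtain s where s: "s \<in> S" using S by blast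
    have "N (\<lambda>t. if t = s then 1 else 0) = (\<Sum>t\<in>S. if t = s then 1 else 0)"
      unfolding N_def by (intro sum.cong) auto
    also have "\<dots> = 1" using s S by simp
    finally have "(\<lambda>t. if t = s then 1 else 0) \<in> K" using s by (auto simp: K_def P_def)
    thus ?thesis by blast
  qed
  moreover have "continuous_on K Q"
    unfolding Q_def by (rule continuous_on_subset[of UNIV]) (intro continuous_intros cont, simp)
  ultimately obtain x where x: "x \<in> K" "\<And>y. y \<in> K \<Longrightarrow> Q y \<le> Q x"
    using continuous_attains_sup by metis
  define l where "l = Q x"
  have x0: "x s \<ge> 0" if "s \<in> S" for s
    using x(1) that by (auto simp: K_def P_def PiE_def Pi_def split: if_splits)
  have Nx: "N x = 1" using x(1) by (simp add: K_def)
  have max: "Q y \<le> l * N y" if y: "\<And>s. s \<in> S \<Longrightarrow> y s \<ge> 0" and Ny: "N y > 0" for y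
  proof -
    define y' where "y' s = (if s \<in> S then y s / sqrt (N y) else 0)" for s
    have "N y' = (\<Sum>s\<in>S. (y s)\<^sup>2 / N y)"
      unfolding N_def[of y'] using Ny by (intro sum.cong) (auto simp: y'_def power_divide)
    also have "\<dots> = 1" using Ny by (simp add: N_def flip: sum_divide_distrib)
    finally have Ny': "N y' = 1" .
    have "y' s \<le> 1" if "s \<in> S" for s
    proof -
      have "(y' s)\<^sup>2 \<le> N y'" unfolding N_def using that S by (intro member_le_sum) auto
      thus ?thesis using Ny' by (simp add: abs_square_le_1)
    qed
    hence "y' \<in> K" using Ny' y Ny by (auto simp: K_def P_def y'_def)
    hence "Q y' \<le> l" using x by (simp add: l_def)
    moreover have "Q y' = Q y / N y"
    proof -
      have "Q y' = (\<Sum>s\<in>S. \<Sum>t\<in>S. M s t * y s * y t / N y)"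
        unfolding Q_def using Ny by (intro sum.cong refl) (auto simp: y'_def)
      thus ?thesis by (simp add: Q_def flip: sum_divide_distrib)
    qed
    ultimately show ?thesis using Ny by (simp add: field_simps)
  qed
  define g where "g s = (\<Sum>t\<in>S. M s t * x t)" for s
  have le: "g s \<le> l * x s" if s: "s \<in> S" for s
  proof -
    \<comment> \<open>Compare \<open>Q\<close> with \<open>l * N\<close> at \<open>x\<close> plus
      \<epsilon> times the unit vector at \<open>s\<close>: the constant terms cancel, and a factor
      \<epsilon> can be divided out.\<close>
    have "2 * (g s - l * x s) \<le> \<epsilon> * (l - M s s)" if e: "\<epsilon> > 0" for \<epsilon>
    proof -
      define d where "d t = (if t = s then 1 else 0 :: real)" for t
      define y where "y t = x t + \<epsilon> * d t" for t
      have dsum: "(\<Sum>t\<in>S. f t * d t) = f s" for f :: "'i \<Rightarrow> real"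
        using s S by (simp add: d_def if_distrib cong: if_cong)
      have "N y = (\<Sum>t\<in>S. (x t)\<^sup>2 + (2 * \<epsilon> * x t) * d t + (\<epsilon>\<^sup>2 * d t) * d t)"
        unfolding N_def by (intro sum.cong) (auto simp: y_def power2_eq_square algebra_simps)
      also have "\<dots> = N x + 2 * \<epsilon> * x s + \<epsilon>\<^sup>2"
        unfolding sum.distrib dsum by (simp add: N_def d_def)
      finally have N: "N y = 1 + 2 * \<epsilon> * x s + \<epsilon>\<^sup>2" using Nx by simp
      have inner: "(\<Sum>t\<in>S. M r t * y r * y t) = y r * (g r + \<epsilon> * M r s)" for r
      proof -
        have "(\<Sum>t\<in>S. M r t * y r * y t) = (\<Sum>t\<in>S. y r * (M r t * x t) + (y r * \<epsilon> * M r t) * d t)"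
          by (intro sum.cong) (auto simp: y_def algebra_simps)
        also have "\<dots> = y r * g r + y r * \<epsilon> * M r s"
          unfolding sum.distrib dsum by (simp add: g_def sum_distrib_left)
        finally show ?thesis by (simp add: algebra_simps)
      qed
      have sw: "(\<Sum>r\<in>S. x r * M r s) = g s"
        unfolding g_def using sym s by (intro sum.cong) auto
      have Qx: "(\<Sum>r\<in>S. x r * g r) = l"
        unfolding l_def Q_def g_def sum_distrib_left by (intro sum.cong refl) (simp add: algebra_simps)
      have "Q y = (\<Sum>r\<in>S. x r * g r + \<epsilon> * (x r * M r s) + (\<epsilon> * (g r + \<epsilon> * M r s)) * d r)"
        unfolding Q_def inner by (intro sum.cong) (auto simp: y_def algebra_simps)
      also have "\<dots> = l + \<epsilon> * g s + \<epsilon> * (g s + \<epsilon> * M s s)"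
        unfolding sum.distrib dsum sum_distrib_left[symmetric] sw Qx ..
      finally have Q: "Q y = l + 2 * \<epsilon> * g s + \<epsilon>\<^sup>2 * M s s"
        by (simp add: algebra_simps power2_eq_square)
      have "Q y \<le> l * N y"
      proof (rule max)
        show "y t \<ge> 0" if "t \<in> S" for t using x0[OF that] e by (simp add: y_def d_def)
        show "N y > 0" unfolding N using x0[OF s] e by (simp add: add_pos_nonneg)
      qed
      hence "\<epsilon> * (2 * (g s - l * x s)) \<le> \<epsilon> * (\<epsilon> * (l - M s s))"
        unfolding Q N by (simp add: algebra_simps power2_eq_square)
      thus ?thesis using e by simp
    qed
    from le_all_pos_multiples[OF this] show ?thesis by simp
  qed
  have eq: "g s = l * x s" if s: "s \<in> S" for s
  proof (cases "x s = 0")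
    case True
    have "g s \<ge> 0" unfolding g_def using nonneg s x0 by (intro sum_nonneg mult_nonneg_nonneg) auto
    thus ?thesis using le[OF s] True by simp
  next
    case False
    \<comment> \<open>The slacks \<open>l * x r - g r\<close>, weighted by \<open>x r\<close>, are
      nonnegative and sum to 0, so a slack can be nonzero only where \<open>x\<close>
      vanishes.\<close>
    have "(\<Sum>r\<in>S. x r * (l * x r - g r)) = l * N x - (\<Sum>r\<in>S. x r * g r)"
      by (simp add: N_def sum_distrib_left sum_subtractf algebra_simps power2_eq_square)
    also have "(\<Sum>r\<in>S. x r * g r) = l"
      unfolding l_def Q_def g_def sum_distrib_left by (intro sum.cong refl) (simp add: algebra_simps)
    finally have "(\<Sum>r\<in>S. x r * (l * x r - g r)) = 0" using Nx by simp
    moreover have "x r * (l * x r - g r) \<ge> 0" if "r \<in> S" for r using x0[OF that] le[OF that] by simp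
    ultimately have "x s * (l * x s - g s) = 0" using s S by (subst (asm) sum_nonneg_eq_0_iff) auto
    thus ?thesis using False by simp
  qed
  have "x s > 0" if s: "s \<in> S" for s
  proof (rule ccontr)
    assume "\<not> x s > 0"
    \<comment> \<open>If a coordinate vanished, an edge would lead from the support \<open>A\<close>
      to some \<open>b\<close> with \<open>x b = 0\<close>, and the eigenvalue equation at
      \<open>b\<close> would equate a positive number with 0.\<close>
    define A where "A = {s \<in> S. x s > 0}"
    have "A \<noteq> {}"
    proof
      assume "A = {}"
      hence "x t = 0" if "t \<in> S" for t using x0[OF that] that by (force simp: A_def)
      hence "N x = 0" by (simp add: N_def)
      thus False using Nx by simp
    qed
    moreover have "A \<subseteq> S" "A \<noteq> S" using s \<open>\<not> x s > 0\<close> by (auto simp: A_def)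
    ultimately obtain a b where ab: "a \<in> A" "b \<in> S - A" "M a b > 0" using irr by blast
    have xb: "x b = 0" "x a > 0" "a \<in> S" "b \<in> S" using ab x0[of b] by (auto simp: A_def)
    have "0 < M b a * x a" using ab(3) xb sym[of a b] by simp
    also have "\<dots> \<le> g b"
      unfolding g_def using nonneg x0 xb S by (intro member_le_sum) auto
    also have "g b = 0" using eq[of b] xb by simp
    finally show False by simp
  qed
  thus ?thesis using eq unfolding g_def by blast
qed

section \<open>Colourings and orderings of forests\<close>

lemma degenerate_bipartite:
  assumes "finite C"
    and sym: "\<And>s t. s \<in> C \<Longrightarrow> t \<in> C \<Longrightarrow> E s t \<Longrightarrow> E t s"
    and irrefl: "\<And>s. s \<in> C \<Longrightarrow> \<not> E s s"
    and leaf: "\<And>D. D \<subseteq> C \<Longrightarrow> D \<noteq> {} \<Longrightarrow> \<exists>r\<in>D. \<forall>a\<in>D. \<forall>b\<in>D. E r a \<longrightarrow> E r b \<longrightarrow> a = b"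
  shows "\<exists>X Y. X \<union> Y = C \<and> X \<inter> Y = {} \<and> (\<forall>s\<in>X. \<forall>t\<in>X. \<not> E s t) \<and> (\<forall>s\<in>Y. \<forall>t\<in>Y. \<not> E s t)"
  using assms
proof (induction C rule: finite_psubset_induct)
  case (psubset C)
  show ?case
  proof (cases "C = {}")
    case True
    thus ?thesis by blast
  next
    case False
    \<comment> \<open>Such an \<open>r\<close> has at most one neighbour in \<open>C\<close>. The
      rest is coloured by induction, and \<open>r\<close> joins a part without a neighbour.\<close>
    then obtain r where r: "r \<in> C" "\<forall>a\<in>C. \<forall>b\<in>C. E r a \<longrightarrow> E r b \<longrightarrow> a = b"
      using psubset.prems(3)[of C] by blast
    have "C - {r} \<subset> C" using r by blast
    hence "\<exists>X Y. X \<union> Y = C - {r} \<and> X \<inter> Y = {} \<and> (\<forall>s\<in>X. \<forall>t\<in>X. \<not> E s t) \<and> (\<forall>s\<in>Y. \<forall>t\<in>Y. \<not> E s t)"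
    proof (rule psubset.IH)
      show "\<exists>r\<in>D. \<forall>a\<in>D. \<forall>b\<in>D. E r a \<longrightarrow> E r b \<longrightarrow> a = b" if "D \<subseteq> C - {r}" "D \<noteq> {}" for D
        using psubset.prems(3)[of D] that by blast
    qed (use psubset.prems in auto)
    then obtain X Y where XY: "X \<union> Y = C - {r}" "X \<inter> Y = {}" "\<forall>s\<in>X. \<forall>t\<in>X. \<not> E s t"
      "\<forall>s\<in>Y. \<forall>t\<in>Y. \<not> E s t" by blast
    show ?thesis
    proof (cases "\<exists>a\<in>X. E r a")
      case True
      have nY: "\<not> E r b \<and> \<not> E b r" if "b \<in> Y" for b
      proof -
        obtain a where "a \<in> X" "E r a" using True by blast
        moreover have "b \<noteq> a" "a \<in> C" "b \<in> C" using XY that \<open>a \<in> X\<close> by blast+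
        ultimately show ?thesis using r psubset.prems(1) by blast
      qed
      have nr: "\<not> E r r" using psubset.prems(2) r by blast
      show ?thesis
      proof (rule exI[of _ X], rule exI[of _ "insert r Y"], intro conjI)
        show "X \<union> insert r Y = C" using XY(1) r(1) by auto
        show "X \<inter> insert r Y = {}" using XY(1,2) by auto
        show "\<forall>s\<in>insert r Y. \<forall>t\<in>insert r Y. \<not> E s t" using XY(4) nY nr by auto
      qed (rule XY(3))
    next
      case False
      have nX: "\<not> E r b \<and> \<not> E b r" if "b \<in> X" for b
      proof -
        have "b \<in> C" using XY that by blast
        thus ?thesis using False that r psubset.prems(1) by blast
      qed
      have nr: "\<not> E r r" using psubset.prems(2) r by blast
      show ?thesis
      proof (rule exI[of _ "insert r X"], rule exI[of _ Y], intro conjI)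
        show "insert r X \<union> Y = C" using XY(1) r(1) by auto
        show "insert r X \<inter> Y = {}" using XY(1,2) by auto
        show "\<forall>s\<in>insert r X. \<forall>t\<in>insert r X. \<not> E s t" using XY(3) nX nr by auto
      qed (rule XY(4))
    qed
  qed
qed

text \<open>When unrelated letters commute, both moves keep the product in its conjugacy class:
  \<open>swap\<close> does not change it, and \<open>rotate\<close> conjugates it by the first
  letter.\<close>

inductive cmove :: "('i \<Rightarrow> 'i \<Rightarrow> bool) \<Rightarrow> 'i list \<Rightarrow> 'i list \<Rightarrow> bool" for E where
  swap: "\<not> E s t \<Longrightarrow> cmove E (a @ s # t # b) (a @ t # s # b)"
| rotate: "cmove E (s # u) (u @ [s])"

abbreviation cequiv :: "('i \<Rightarrow> 'i \<Rightarrow> bool) \<Rightarrow> 'i list \<Rightarrow> 'i list \<Rightarrow> bool" where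
  "cequiv E \<equiv> equivclp (cmove E)"

lemma cequiv_trans [trans]: "cequiv E u v \<Longrightarrow> cequiv E v w \<Longrightarrow> cequiv E u w"
  by (rule equivclp_trans)

lemma cequiv_sym: "cequiv E u v \<Longrightarrow> cequiv E v u"
  by (rule equivclp_sym)

lemma cmove_cequiv: "cmove E u v \<Longrightarrow> cequiv E u v"
  by (rule r_into_equivclp)

lemma cequiv_rotate: "cequiv E (u @ v) (v @ u)"
proof (induction u arbitrary: v)
  case (Cons s u)
  have "cequiv E ((s # u) @ v) ((u @ v) @ [s])"
    using cmove_cequiv[OF cmove.rotate[of E s "u @ v"]] by simp
  also have "cequiv E ((u @ v) @ [s]) ((v @ [s]) @ u)" using Cons.IH[of "v @ [s]"] by simp
  finally show ?case by simp
qed simp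

lemma cequiv_commute_past:
  assumes "\<forall>t\<in>set y. \<not> E t s"
  shows "cequiv E (a @ y @ [s] @ b) (a @ [s] @ y @ b)"
  using assms
proof (induction y arbitrary: b rule: rev_induct)
  case (snoc t y)
  have "cequiv E (a @ (y @ [t]) @ [s] @ b) (a @ y @ [s] @ t # b)"
    using cmove.swap[of E t s "a @ y" b] snoc.prems by (simp add: cmove_cequiv)
  also have "cequiv E (a @ y @ [s] @ t # b) (a @ [s] @ y @ t # b)"
    using snoc by simp
  finally show ?case by simp
qed simp

lemma cmove_distinct: "cmove E u v \<Longrightarrow> (distinct u \<longleftrightarrow> distinct v) \<and> set u = set v"
  by (induction rule: cmove.induct) auto

text \<open>The obstacle is rotating the neighbour \<open>t\<close> of \<open>r\<close>, since
  \<open>r\<close> cannot commute past it. Then \<open>r\<close> goes around: it is rotated to the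
  end and commutes back past all letters other than \<open>t\<close>.\<close>

lemma cequiv_Cons_leaf:
  assumes "cmove E p q" "distinct p" "set p \<subseteq> C"
    and sym: "\<And>s. s \<in> C \<Longrightarrow> E s r \<Longrightarrow> E r s"
    and leaf: "\<And>a b. a \<in> C \<Longrightarrow> b \<in> C \<Longrightarrow> E r a \<Longrightarrow> E r b \<Longrightarrow> a = b"
  shows "cequiv E (r # p) (r # q)"
  using assms(1-3)
proof cases
  case (swap s t a b)
  thus ?thesis using cmove.swap[of E s t "r # a" b] by (simp add: cmove_cequiv)
next
  case (rotate t y)
  show ?thesis
  proof (cases "E r t")
    case False
    have "cequiv E (r # t # y) (t # r # y)"
      using cmove.swap[of E r t "[]" y] False by (simp add: cmove_cequiv)
    also have "cequiv E (t # r # y) (r # y @ [t])"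
      using cmove_cequiv[OF cmove.rotate[of E t "r # y"]] by simp
    finally show ?thesis using rotate by simp
  next
    case True
    have nE: "\<forall>b\<in>set y. \<not> E b r"
    proof (intro ballI notI)
      fix b assume b: "b \<in> set y" "E b r"
      hence "b \<in> C" "t \<in> C" "b \<noteq> t" using rotate assms(2,3) by auto
      thus False using True b sym leaf by blast
    qed
    have "cequiv E (r # t # y) ([t] @ y @ [r] @ [])"
      using cmove_cequiv[OF cmove.rotate[of E r "t # y"]] by simp
    also have "cequiv E ([t] @ y @ [r] @ []) ([t] @ [r] @ y @ [])"
      using nE by (intro cequiv_commute_past)
    also have "cequiv E ([t] @ [r] @ y @ []) (r # y @ [t])"
      using cmove_cequiv[OF cmove.rotate[of E t "r # y"]] by simp
    finally show ?thesis using rotate by simp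
  qed
qed

text \<open>Both words are rotated to start with a vertex \<open>r\<close> having at most one
  neighbour; a chain of moves between the remaining words, given by induction, is then lifted move
  by move.\<close>

lemma degenerate_cequiv:
  assumes "finite C"
    and sym: "\<And>s t. s \<in> C \<Longrightarrow> t \<in> C \<Longrightarrow> E s t \<Longrightarrow> E t s"
    and leaf: "\<And>D. D \<subseteq> C \<Longrightarrow> D \<noteq> {} \<Longrightarrow> \<exists>r\<in>D. \<forall>a\<in>D. \<forall>b\<in>D. E r a \<longrightarrow> E r b \<longrightarrow> a = b"
    and "distinct u" "set u = C" "distinct v" "set v = C"
  shows "cequiv E u v"
  using assms
proof (induction C arbitrary: u v rule: finite_psubset_induct)
  case (psubset C)
  show ?case
  proof (cases "C = {}")
    case True
    thus ?thesis using psubset.prems by simp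
  next
    case False
    then obtain r where r: "r \<in> C" "\<forall>a\<in>C. \<forall>b\<in>C. E r a \<longrightarrow> E r b \<longrightarrow> a = b"
      using psubset.prems(2)[of C] by blast
    have *: "\<exists>u'. cequiv E u (r # u') \<and> distinct u' \<and> set u' = C - {r}"
      if u: "distinct u" "set u = C" for u
    proof -
      obtain a b where ab: "u = a @ r # b" using u r by (metis split_list)
      have "cequiv E u (r # b @ a)" using cequiv_rotate[of E a "r # b"] ab by simp
      moreover have "distinct (b @ a)" "set (b @ a) = C - {r}" using u ab by auto
      ultimately show ?thesis by blast
    qed
    obtain u' where u': "cequiv E u (r # u')" "distinct u'" "set u' = C - {r}"
      using *[OF psubset.prems(3,4)] by blast
    obtain v' where v': "cequiv E v (r # v')" "distinct v'" "set v' = C - {r}"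
      using *[OF psubset.prems(5,6)] by blast
    have "C - {r} \<subset> C" using r by blast
    hence "cequiv E u' v'"
    proof (rule psubset.IH)
      show "\<exists>r\<in>D. \<forall>a\<in>D. \<forall>b\<in>D. E r a \<longrightarrow> E r b \<longrightarrow> a = b" if "D \<subseteq> C - {r}" "D \<noteq> {}" for D
        using psubset.prems(2)[of D] that by blast
    qed (use psubset.prems u' v' in auto)
    hence "cequiv E (r # u') (r # v') \<and> distinct v' \<and> set v' = C - {r}"
    proof (induction rule: equivclp_induct)
      case (step y z)
      have d: "distinct z" "set z = C - {r}"
        using step(2,3) by (auto dest: cmove_distinct)
      have "cequiv E (r # y) (r # z)"
        using step(2)
      proof
        assume m: "cmove E y z"
        show ?thesis
          by (rule cequiv_Cons_leaf[OF m, of C]) (use step(3) r psubset.prems(1) in auto)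
      next
        assume m: "cmove E z y"
        show ?thesis
          by (rule cequiv_sym, rule cequiv_Cons_leaf[OF m, of C]) (use d r psubset.prems(1) in auto)
      qed
      thus ?case using step(3) d cequiv_trans by blast
    qed (use u' in simp)
    hence "cequiv E (r # u') (r # v')" by simp
    from cequiv_trans[OF u'(1) cequiv_trans[OF this cequiv_sym[OF v'(1)]]] show ?thesis .
  qed
qed


section \<open>Finite irreducible Coxeter groups\<close>

text \<open>For \<open>l = 2 * cos \<phi>\<close> with \<phi> in the open interval from 0 to \<pi>
  this is sin((k - 1/2) \<phi>) / sin(\<phi> / 2). After \<open>k\<close> blocks the Perron vector
  is scaled by \<open>eseq l (Suc k)\<close> on the block due next and by \<open>- eseq l k\<close>
  on the other; the start -1, 1 encodes the unscaled vector.\<close>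

fun eseq :: "real \<Rightarrow> nat \<Rightarrow> real" where
  "eseq l 0 = -1"
| "eseq l (Suc 0) = 1"
| "eseq l (Suc (Suc k)) = l * eseq l (Suc k) - eseq l k"

lemma length_alt_even: "length (alt (2 * k) xs ys) = k * (length xs + length ys)"
  by (induction k) (auto simp: algebra_simps)

context coxeter_system
begin

section \<open>The longest element and the leaves of the diagram\<close>

lemma parabolic_S: "parabolic S = carrier W"
  using ex_word by (force simp: parabolic_def)

definition longest :: "'a \<Rightarrow> bool" where
  "longest w \<longleftrightarrow> w \<in> carrier W \<and> (\<forall>s\<in>S. desc w s)"

lemma ex_longest:
  assumes "finite (carrier W)"
  shows "\<exists>w. longest w"
proof -
  have "Max (len ` carrier W) \<in> len ` carrier W" using assms by (intro Max_in) auto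
  then obtain w where w: "w \<in> carrier W" "len w = Max (len ` carrier W)" by auto
  have le: "len x \<le> len w" if "x \<in> carrier W" for x using that assms w by simp
  have "desc w s" if "s \<in> S" for s
    using le[of "w \<otimes> s"] len_right_neq[OF w(1) that] w that by simp
  thus ?thesis using w by (auto simp: longest_def)
qed

lemma longest_unique: "longest w \<Longrightarrow> longest w' \<Longrightarrow> w = w'"
  using parabolic_longest_unique[of S w w'] by (simp add: longest_def parabolic_S)

lemma len_longest_mult:
  assumes "longest w0" "x \<in> carrier W"
  shows "len (w0 \<otimes> x) + len x = len w0"
  using len_parabolic_desc[of w0 S x] assms by (simp add: longest_def parabolic_S)

lemma longest_square:
  assumes "longest w0"
  shows "w0 \<otimes> w0 = \<one>"
  using len_longest_mult[OF assms, of w0] assms by (simp add: longest_def len_eq_0)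

lemma rle_longest:
  assumes "longest w0" "w \<in> carrier W"
  shows "rle w w0"
proof -
  have w0: "w0 \<in> carrier W" using assms by (simp add: longest_def)
  define x where "x = inv w0 \<otimes> w"
  have x: "x \<in> carrier W" "w0 \<otimes> x = w" "inv w \<otimes> w0 = inv x"
    using w0 assms by (simp_all add: x_def inv_mult_group flip: m_assoc)
  show ?thesis unfolding rle_iff x(3) using len_longest_mult[OF assms(1) x(1)] x by simp
qed

text \<open>If every vertex of \<open>C\<close> had two neighbours in \<open>C\<close>, then the sum of the values over \<open>C\<close> could
  only grow during the numbers game, whereas the longest element makes all values negative.\<close>

lemma finite_leaf:
  assumes fin: "finite (carrier W)" and C: "C \<subseteq> S" "C \<noteq> {}"
  shows "\<exists>r\<in>C. \<forall>a\<in>C. \<forall>b\<in>C. 3 \<le> m r a \<longrightarrow> 3 \<le> m r b \<longrightarrow> a = b"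
proof (rule ccontr)
  assume "\<not> ?thesis"
  hence two: "\<exists>a\<in>C. \<exists>b\<in>C. 3 \<le> m r a \<and> 3 \<le> m r b \<and> a \<noteq> b" if "r \<in> C" for r
    using that by blast
  have finS: "finite S" using fin gens_subset finite_subset by blast
  hence finC: "finite C" using C finite_subset by blast
  \<comment> \<open>For \<open>r\<close> in \<open>C\<close> the diagonal entry -2 is compensated by
    two neighbours with entries at least 1.\<close>
  have row: "(\<Sum>t\<in>C. bond r t) \<ge> 0" if r: "r \<in> S" for r
  proof (cases "r \<in> C")
    case False
    thus ?thesis using bond_nonneg[OF r] C by (intro sum_nonneg) auto
  next
    case True
    obtain a b where ab: "a \<in> C" "b \<in> C" "3 \<le> m r a" "3 \<le> m r b" "a \<noteq> b" using two True by blast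
    have "\<not> 3 \<le> m r r" using m_self[OF r] by (simp add: one_enat_def numeral_eq_enat)
    hence ne: "a \<noteq> r" "b \<noteq> r" using ab by auto
    have "(\<Sum>t\<in>{r, a, b}. bond r t) \<le> (\<Sum>t\<in>C. bond r t)"
    proof (rule sum_mono2[OF finC])
      show "{r, a, b} \<subseteq> C" using ab True by blast
      show "bond r t \<ge> 0" if "t \<in> C - {r, a, b}" for t
        using that C r by (intro bond_nonneg) auto
    qed
    moreover have "(\<Sum>t\<in>{r, a, b}. bond r t) = bond r r + bond r a + bond r b"
      using ne ab(5) by simp
    ultimately show ?thesis using bond_ge_1[OF ab(3)] bond_ge_1[OF ab(4)] bond_self[OF r] by linarith
  qed
  define F where "F z = (\<Sum>t\<in>C. z t)" for z :: "'a \<Rightarrow> real"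
  have F_fire: "F (fire z s) = F z + z s * (\<Sum>t\<in>C. bond s t)" for z s
    by (simp add: F_def fire_def sum.distrib sum_distrib_left mult.commute)
  let ?z = "\<lambda>_. 1 :: real"
  have F_mono: "F (zact ?z v) \<ge> F ?z" if "v \<in> lists S" "length v = len (ev v)" for v
    using that
  proof (induction v rule: rev_induct)
    case (snoc t v)
    have t: "v \<in> lists S" "t \<in> S" using snoc.prems by auto
    note r = reduced_snoc[OF t snoc.prems(2)]
    have "zact ?z v t > 0" using zact_pos[OF t(1) _ t(2) r(2)] by simp
    hence "zact ?z v t * (\<Sum>i\<in>C. bond t i) \<ge> 0" using row[OF t(2)] by simp
    thus ?case using snoc.IH[OF t(1) r(1)] by (simp add: F_fire)
  qed simp
  obtain w0 where w0: "longest w0" using ex_longest[OF fin] by blast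
  obtain v where v: "v \<in> lists S" "length v = len w0" "ev v = w0"
    using ex_reduced_word w0 by (auto simp: longest_def)
  have neg: "zact ?z v t < 0" if "t \<in> C" for t
    using zact_neg[OF v(1), of ?z t] w0 v that C by (auto simp: longest_def)
  have "F (zact ?z v) < 0" unfolding F_def using neg sum_strict_mono[OF finC C(2), of "zact ?z v" "\<lambda>_. 0"] by simp
  moreover have "F ?z \<ge> 0" by (simp add: F_def)
  ultimately show False using F_mono[OF v(1)] v by simp
qed

lemma connected_cut:
  assumes irr: "irreducible_coxeter S m" and A: "A \<subseteq> S" "A \<noteq> {}" "A \<noteq> S"
  shows "\<exists>s\<in>A. \<exists>t\<in>S - A. 3 \<le> m s t"
proof (rule ccontr)
  assume no: "\<not> ?thesis"
  obtain a b where ab: "a \<in> A" "b \<in> S" "b \<notin> A" using A by blast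
  let ?R = "{(s, t). s \<in> S \<and> t \<in> S \<and> s \<noteq> t \<and> 3 \<le> m s t}\<^sup>s"
  have "(a, b) \<in> rtrancl_on S ?R"
    using irr ab A unfolding irreducible_coxeter_def connected_conv
    by (auto simp: coxeter_diagram_def)
  hence "b \<in> A"
  proof (induction rule: rtrancl_on_induct)
    case base
    show ?case by (rule ab(1))
  next
    case (step y z)
    have "3 \<le> m y z" using step(2) m_sym by (auto simp: symcl_def)
    thus ?case using step no by blast
  qed
  thus False using ab by blast
qed

section \<open>Conjugacy of Coxeter elements\<close>

lemma conjg_mult: "g \<in> carrier W \<Longrightarrow> x \<in> carrier W \<Longrightarrow> y \<in> carrier W \<Longrightarrow>
    conjg g (x \<otimes> y) = conjg g x \<otimes> conjg g y"
  by (simp add: conjg_def m_assoc) (simp flip: m_assoc)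

lemma conjg_pow: "g \<in> carrier W \<Longrightarrow> x \<in> carrier W \<Longrightarrow> conjg g (x [^] (n::nat)) = conjg g x [^] n"
  by (induction n) (auto simp: conjg_mult, simp add: conjg_def)

lemma cmove_conjugate:
  assumes "cmove (\<lambda>s t. 3 \<le> m s t) u v" "u \<in> lists S"
  shows "\<exists>g\<in>carrier W. ev v = conjg g (ev u)"
  using assms
proof cases
  case (swap s t a b)
  hence S: "s \<in> S" "t \<in> S" "a \<in> lists S" "b \<in> lists S" using assms(2) by auto
  have "s \<otimes> (t \<otimes> ev b) = t \<otimes> (s \<otimes> ev b)"
    using gens_commute[OF S(1,2)] swap S by (simp flip: m_assoc)
  hence "ev v = ev u" using swap S by simp
  thus ?thesis using assms(2) by (intro bexI[of _ \<one>]) auto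
next
  case (rotate s u')
  hence "s \<in> S" "u' \<in> lists S" using assms(2) by auto
  thus ?thesis using rotate by (intro bexI[of _ s]) (auto simp: conjg_def m_assoc)
qed

lemma cmove_lists: "cmove E u v \<Longrightarrow> u \<in> lists A \<longleftrightarrow> v \<in> lists A"
  by (auto dest!: cmove_distinct simp: in_lists_conv_set)

lemma cequiv_conjugate:
  assumes "cequiv (\<lambda>s t. 3 \<le> m s t) u v" "u \<in> lists S"
  shows "v \<in> lists S \<and> (\<exists>g\<in>carrier W. ev v = conjg g (ev u))"
  using assms(1)
proof (induction rule: equivclp_induct)
  case base
  show ?case using assms(2) by (auto intro!: bexI[of _ \<one>])
next
  case (step y z)
  have y: "y \<in> lists S" using step.IH by blast
  hence z: "z \<in> lists S" using step(2) cmove_lists by blast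
  have "\<exists>g\<in>carrier W. ev z = conjg g (ev y)"
    using step(2)
  proof
    assume "cmove (\<lambda>s t. 3 \<le> m s t) z y"
    then obtain g where g: "g \<in> carrier W" "conjg g (ev z) = ev y" using cmove_conjugate z by metis
    hence "ev z = conjg (inv g) (ev y)" using conjg_eq_iff y z by simp
    thus ?thesis using g by blast
  qed (use cmove_conjugate y in blast)
  then obtain g where g: "g \<in> carrier W" "ev z = conjg g (ev y)" by blast
  obtain h where h: "h \<in> carrier W" "ev y = conjg h (ev u)" using step.IH by blast
  have "ev z = conjg (g \<otimes> h) (ev u)" using g h assms(2) by (simp add: conjg_conj)
  thus ?case using z g h by blast
qed

text \<open>The Coxeter number comes with an arbitrary ordering of the generators, whereas the
  bipartite argument needs one part listed after the other. Moves conjugate the product, which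
  preserves the set of trivial powers.\<close>

lemma coxeter_words_same_order:
  assumes "finite (carrier W)" "distinct u" "set u = S" "distinct v" "set v = S"
  shows "ev u [^] n = \<one> \<longleftrightarrow> ev v [^] (n::nat) = \<one>"
proof -
  have finS: "finite S" using assms(3) by (metis List.finite_set)
  have uv: "u \<in> lists S" "v \<in> lists S" using assms by (auto simp: in_lists_conv_set)
  have "cequiv (\<lambda>s t. 3 \<le> m s t) u v"
  proof (rule degenerate_cequiv[of S])
    show "\<exists>r\<in>D. \<forall>a\<in>D. \<forall>b\<in>D. 3 \<le> m r a \<longrightarrow> 3 \<le> m r b \<longrightarrow> a = b" if "D \<subseteq> S" "D \<noteq> {}" for D
      using finite_leaf[OF assms(1) that] .
  qed (use assms finS m_sym in auto)
  then obtain g where g: "g \<in> carrier W" "ev v = conjg g (ev u)" using cequiv_conjugate uv by blast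
  have "ev v [^] n = conjg g (ev u [^] n)" using conjg_pow[OF g(1) ev_closed[OF uv(1)]] g by simp
  hence "ev v [^] n = \<one> \<longleftrightarrow> ev u [^] n = conjg (inv g) \<one>"
    using conjg_eq_iff[of g "ev u [^] n" \<one>] g uv by simp
  also have "conjg (inv g) \<one> = \<one>" using g by (simp add: conjg_def)
  finally show ?thesis by blast
qed

text \<open>Letters of a commuting block do not affect each other's values, so the block fires as
  one simultaneous move.\<close>

lemma zact_block:
  assumes "commuting B" "distinct B" "t \<in> S"
  shows "zact z B t = (if t \<in> set B then - z t else z t + (\<Sum>s\<in>set B. bond s t * z s))"
  using assms(1,2)
proof (induction B arbitrary: z)
  case (Cons s B)
  have s: "s \<in> S" "commuting B" "distinct B" "s \<notin> set B" and BS: "set B \<subseteq> S"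
    using Cons.prems by (auto simp: commuting_def in_lists_conv_set)
  have b0: "bond s r = 0" "bond r s = 0" if "r \<in> set B" for r
  proof -
    have "\<not> 3 \<le> m s r" "\<not> 3 \<le> m r s" using Cons.prems(1) that by (auto simp: commuting_def)
    moreover have "r \<noteq> s" "r \<in> S" using that s BS by auto
    ultimately show "bond s r = 0" "bond r s = 0" using bond_eq_0 s by auto
  qed
  have f: "fire z s r = z r" if "r \<in> set B" for r using b0[OF that] by (simp add: fire_def)
  have sum: "(\<Sum>r\<in>set B. bond r t * fire z s r) = (\<Sum>r\<in>set B. bond r t * z r)"
    using f by (intro sum.cong) auto
  consider "t \<in> set B" | "t = s" | "t \<notin> set B" "t \<noteq> s" by blast
  thus ?case
  proof cases
    case 1
    thus ?thesis using Cons.IH[OF s(2,3)] f s by auto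
  next
    case 2
    have "(\<Sum>r\<in>set B. bond r s * z r) = 0" using b0 by (intro sum.neutral) auto
    thus ?thesis using Cons.IH[OF s(2,3), of "fire z s"] s 2 sum by (simp add: fire_self)
  next
    case 3
    thus ?thesis using Cons.IH[OF s(2,3), of "fire z s"] s sum by (simp add: fire_def)
  qed
qed simp

text \<open>Earlier letters of the block leave the value at a later one untouched, so it is still
  positive when its turn comes and the letter is an ascent.\<close>

lemma len_append_block:
  assumes "commuting B" "distinct B" "u \<in> lists S" "len (ev u) = length u"
    and "\<And>t. t \<in> S \<Longrightarrow> z t > 0" "\<And>s. s \<in> set B \<Longrightarrow> zact z u s > 0"
  shows "len (ev (u @ B)) = length (u @ B)"
  using assms(1,2,6)
proof (induction B rule: rev_induct)
  case (snoc s B)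
  have c: "commuting B" "B \<in> lists S" "s \<in> S" "distinct B" "s \<notin> set B"
    using snoc.prems(1,2) by (auto simp: commuting_def)
  have "bond r s = 0" if "r \<in> set B" for r
  proof -
    have "r \<in> S" "r \<noteq> s" using that c by (auto simp: in_lists_conv_set)
    moreover have "\<not> 3 \<le> m r s" using snoc.prems(1) that by (auto simp: commuting_def)
    ultimately show ?thesis using bond_eq_0 c by blast
  qed
  hence "zact z (u @ B) s = zact z u s"
    using zact_block[OF c(1,4,3), of "zact z u"] c(5) by simp
  hence "zact z (u @ B) s > 0" using snoc.prems(3) by simp
  hence "\<not> desc (ev (u @ B)) s"
    using zact_neg[of "u @ B" z s] assms(3,5) c(2,3) by fastforce
  moreover have uB: "u @ B \<in> lists S" using assms(3) c by simp
  ultimately have "len (ev (u @ B) \<otimes> s) = len (ev (u @ B)) + 1"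
    using ascent_len[OF ev_closed[OF uB] c(3)] by blast
  moreover have "ev (u @ B @ [s]) = ev (u @ B) \<otimes> s" using assms(3) c by (simp add: m_assoc)
  ultimately show ?case using snoc.IH[OF c(1,4)] snoc.prems(3) by simp
qed (use assms in simp)

definition bipartition :: "'a list \<Rightarrow> 'a list \<Rightarrow> bool" where
  "bipartition xs ys \<longleftrightarrow> commuting xs \<and> commuting ys \<and> distinct xs \<and> distinct ys \<and>
     set xs \<union> set ys = S \<and> set xs \<inter> set ys = {}"

lemma bipartition_sym: "bipartition xs ys \<Longrightarrow> bipartition ys xs"
  by (auto simp: bipartition_def)

lemma bipartition_lists: "bipartition xs ys \<Longrightarrow> xs \<in> lists S \<and> ys \<in> lists S"
  by (auto simp: bipartition_def commuting_def)

lemma ex_bipartition: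
  assumes "finite (carrier W)"
  shows "\<exists>xs ys. bipartition xs ys"
proof -
  have finS: "finite S" using assms gens_subset finite_subset by blast
  have "\<exists>X Y. X \<union> Y = S \<and> X \<inter> Y = {} \<and> (\<forall>s\<in>X. \<forall>t\<in>X. \<not> 3 \<le> m s t) \<and> (\<forall>s\<in>Y. \<forall>t\<in>Y. \<not> 3 \<le> m s t)"
  proof (rule degenerate_bipartite[OF finS])
    show "\<exists>r\<in>D. \<forall>a\<in>D. \<forall>b\<in>D. 3 \<le> m r a \<longrightarrow> 3 \<le> m r b \<longrightarrow> a = b" if "D \<subseteq> S" "D \<noteq> {}" for D
      using finite_leaf[OF assms that] .
    show "3 \<le> m t s" if "s \<in> S" "t \<in> S" "3 \<le> m s t" for s t using that m_sym by simp
    show "\<not> 3 \<le> m s s" if "s \<in> S" for s using m_self[OF that] by (simp add: one_enat_def numeral_eq_enat)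
  qed
  then obtain X Y where XY: "X \<union> Y = S" "X \<inter> Y = {}" "\<forall>s\<in>X. \<forall>t\<in>X. \<not> 3 \<le> m s t"
    "\<forall>s\<in>Y. \<forall>t\<in>Y. \<not> 3 \<le> m s t" by blast
  have "finite X" "finite Y" using XY(1) finS by (metis finite_Un)+
  then obtain xs ys where "set xs = X" "distinct xs" "set ys = Y" "distinct ys"
    using finite_distinct_list by metis
  thus ?thesis using XY
    by (intro exI[of _ xs] exI[of _ ys]) (auto simp: bipartition_def commuting_def in_lists_conv_set)
qed

text \<open>In the plane spanned by the two halves of the Perron vector \<open>x\<close> the numbers game played in
  blocks reduces to a linear recurrence.\<close>

lemma zact_alt:
  assumes bip: "bipartition xs ys"
    and x: "\<And>s. s \<in> S \<Longrightarrow> (\<Sum>t\<in>S. (if s = t then 0 else bond s t) * x t) = l * x s"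
    and t: "t \<in> S"
  shows "zact x (alt k xs ys) t =
    (if t \<in> set (if even k then xs else ys) then eseq l (Suc k) * x t else - eseq l k * x t)"
  using t
proof (induction k arbitrary: t)
  case 0
  thus ?case by simp
next
  case (Suc k)
  define N where "N = (if even k then xs else ys)"
  define N' where "N' = (if even k then ys else xs)"
  have NO: "commuting N" "distinct N" "set N \<union> set N' = S" "set N \<inter> set N' = {}" "commuting N'"
    using bip by (auto simp: bipartition_def N_def N'_def)
  have next': "(if even (Suc k) then xs else ys) = N'" by (simp add: N'_def)
  have z: "zact x (alt k xs ys) s = (if s \<in> set N then eseq l (Suc k) * x s else - eseq l k * x s)"
    if "s \<in> S" for s using Suc.IH[OF that] by (simp add: N_def)
  have "zact x (alt (Suc k) xs ys) t = zact (zact x (alt k xs ys)) N t"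
    unfolding alt_snoc by (simp add: N_def)
  also have "\<dots> = (if t \<in> set N then - zact x (alt k xs ys) t
      else zact x (alt k xs ys) t + (\<Sum>s\<in>set N. bond s t * zact x (alt k xs ys) s))"
    by (rule zact_block[OF NO(1,2) Suc.prems])
  also have "\<dots> = (if t \<in> set N' then eseq l (Suc (Suc k)) * x t else - eseq l (Suc k) * x t)"
  proof (cases "t \<in> set N")
    case True
    thus ?thesis using z[OF Suc.prems] NO(4) by auto
  next
    case False
    hence tO: "t \<in> set N'" using NO(3) Suc.prems by blast
    have finS: "finite S" using NO(3) by (metis List.finite_set finite_Un)
    have "(\<Sum>s\<in>set N. bond s t * zact x (alt k xs ys) s) = (\<Sum>s\<in>set N. eseq l (Suc k) * (bond t s * x s))"
    proof (intro sum.cong refl)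
      fix s assume s: "s \<in> set N"
      hence "s \<in> S" using NO(3) by blast
      thus "bond s t * zact x (alt k xs ys) s = eseq l (Suc k) * (bond t s * x s)"
        using z s Suc.prems bond_sym[of s t] by simp
    qed
    also have "\<dots> = eseq l (Suc k) * (\<Sum>s\<in>set N. bond t s * x s)"
      by (simp add: sum_distrib_left)
    \<comment> \<open>All neighbours of \<open>t\<close> lie in \<open>N\<close>, because
      \<open>t\<close> belongs to the other part; so the sum extends to \<open>S\<close>, where the
      eigenvalue equation applies.\<close>
    also have "(\<Sum>s\<in>set N. bond t s * x s) = (\<Sum>s\<in>S. (if t = s then 0 else bond t s) * x s)"
    proof (rule sum.mono_neutral_cong_left[OF finS])
      show "set N \<subseteq> S" using NO(3) by blast
      show "\<forall>s\<in>S - set N. (if t = s then 0 else bond t s) * x s = 0"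
      proof
        fix s assume s: "s \<in> S - set N"
        have "s \<in> set N'" using s NO(3) by blast
        hence "\<not> 3 \<le> m t s" using NO(5) tO by (auto simp: commuting_def)
        thus "(if t = s then 0 else bond t s) * x s = 0" using bond_eq_0[of t s] s Suc.prems by auto
      qed
      show "bond t s * x s = (if t = s then 0 else bond t s) * x s" if "s \<in> set N" for s
        using that False by auto
    qed
    also have "\<dots> = l * x t" by (rule x[OF Suc.prems])
    finally show ?thesis using False tO z[OF Suc.prems] by (simp add: algebra_simps)
  qed
  finally show ?case unfolding next' .
qed

lemma ev_alt_even: "xs \<in> lists S \<Longrightarrow> ys \<in> lists S \<Longrightarrow> ev (alt (2 * k) xs ys) = ev (xs @ ys) [^] k"
proof (induction k)
  case (Suc k)
  have "ev (alt (2 * Suc k) xs ys) = ev (xs @ ys) \<otimes> ev (alt (2 * k) xs ys)"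
    using Suc.prems by (simp add: m_assoc alt_lists)
  also have "\<dots> = ev (xs @ ys) [^] Suc k"
    using Suc nat_pow_Suc2[of "ev (xs @ ys)" k] by simp
  finally show ?case .
qed simp

text \<open>Positive scaling factors keep alternating words reduced. The factors depend only on the
  number of blocks, so both starting blocks reach the longest element at the same moment.\<close>

lemma alternating_longest:
  assumes fin: "finite (carrier W)" and irr: "irreducible_coxeter S m"
    and h: "has_coxeter_number W S h" and bip: "bipartition xs ys"
  shows "h > 0 \<and> longest (ev (alt h xs ys)) \<and> longest (ev (alt h ys xs))"
proof -
  have S: "finite S" "S \<noteq> {}"
    using fin gens_subset finite_subset irr
    by (auto simp: irreducible_coxeter_def connected_conv coxeter_diagram_def)
  define M where "M s t = (if s = t then 0 else bond s t)" for s t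
  have "\<exists>x l. (\<forall>s\<in>S. x s > 0) \<and> (\<forall>s\<in>S. (\<Sum>t\<in>S. M s t * x t) = l * x s)"
  proof (rule perron_symmetric[OF S])
    show "M s t = M t s" if "s \<in> S" "t \<in> S" for s t using that bond_sym by (simp add: M_def)
    show "M s t \<ge> 0" if "s \<in> S" "t \<in> S" for s t using that bond_nonneg by (simp add: M_def)
    fix A assume A: "A \<subseteq> S" "A \<noteq> {}" "A \<noteq> S"
    then obtain s t where st: "s \<in> A" "t \<in> S - A" "3 \<le> m s t" using connected_cut irr by blast
    hence "M s t > 0" using bond_ge_1[OF st(3)] by (auto simp: M_def)
    thus "\<exists>s\<in>A. \<exists>t\<in>S - A. M s t > 0" using st by blast
  qed
  then obtain x l where x: "\<And>s. s \<in> S \<Longrightarrow> x s > 0"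
    "\<And>s. s \<in> S \<Longrightarrow> (\<Sum>t\<in>S. (if s = t then 0 else bond s t) * x t) = l * x s"
    unfolding M_def by blast
  have state: "zact x (alt k us vs) t =
      (if t \<in> set (if even k then us else vs) then eseq l (Suc k) * x t else - eseq l k * x t)"
    if "bipartition us vs" "t \<in> S" for us vs k t
    by (rule zact_alt[OF that(1) x(2) that(2)])
  have reduced: "len (ev (alt k us vs)) = length (alt k us vs)"
    if b: "bipartition us vs" and pos: "\<And>j. j < k \<Longrightarrow> eseq l (Suc j) > 0" for k us vs
    using pos
  proof (induction k)
    case (Suc k)
    let ?N = "if even k then us else vs"
    have N: "commuting ?N" "distinct ?N" "set ?N \<subseteq> S" using b by (auto simp: bipartition_def)
    have "len (ev (alt k us vs @ ?N)) = length (alt k us vs @ ?N)"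
    proof (rule len_append_block[OF N(1,2), where z = x])
      show "alt k us vs \<in> lists S" using bipartition_lists[OF b] by (auto intro: alt_lists)
      show "len (ev (alt k us vs)) = length (alt k us vs)" using Suc by simp
      show "x t > 0" if "t \<in> S" for t by (rule x(1)[OF that])
      show "zact x (alt k us vs) s > 0" if s: "s \<in> set ?N" for s
      proof -
        have "s \<in> S" using s N(3) by blast
        thus ?thesis using state[OF b, of s k] s x(1)[of s] Suc.prems[of k] by simp
      qed
    qed
    thus ?case unfolding alt_snoc .
  qed simp
  have len_S: "length xs + length ys > 0"
    using S(2) bip by (auto simp: bipartition_def)
  \<comment> \<open>If the factors stayed positive forever, lengths in the finite group would be
    unbounded.\<close>
  have ex: "\<exists>k. \<not> eseq l (Suc k) > 0"
  proof (rule ccontr)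
    assume "\<not> ?thesis"
    hence "len (ev (alt (2 * k) xs ys)) = length (alt (2 * k) xs ys)" for k
      using reduced[OF bip, of "2 * k"] by blast
    hence len_k: "len (ev (alt (2 * k) xs ys)) \<ge> k" for k
      using len_S unfolding length_alt_even by (cases "length xs + length ys") auto
    have "len (ev (alt (2 * k) xs ys)) \<le> Max (len ` carrier W)" for k
      using fin bipartition_lists[OF bip] by (intro Max_ge) (auto intro!: imageI ev_closed alt_lists)
    thus False using len_k[of "Suc (Max (len ` carrier W))"] by (meson not_less_eq_eq order_trans)
  qed
  define K where "K = (LEAST k. \<not> eseq l (Suc k) > 0)"
  have K: "eseq l (Suc K) \<le> 0" "\<And>j. j < K \<Longrightarrow> eseq l (Suc j) > 0"
    using LeastI_ex[OF ex] not_less_Least[of _ "\<lambda>k. \<not> eseq l (Suc k) > 0"] by (auto simp: K_def)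
  have "K \<noteq> 0"
  proof
    assume "K = 0"
    thus False using K(1) by simp
  qed
  then obtain K' where K': "K = Suc K'" by (cases K) auto
  have eK: "eseq l K > 0" unfolding K' using K(2)[of K'] K' by simp
  have long: "longest (ev (alt K us vs))" if b: "bipartition us vs" for us vs
    unfolding longest_def
  proof (intro conjI ballI)
    have w: "alt K us vs \<in> lists S" using bipartition_lists[OF b] by (auto intro: alt_lists)
    thus "ev (alt K us vs) \<in> carrier W" by simp
    fix t assume t: "t \<in> S"
    \<comment> \<open>The block due next has the factor \<open>eseq l (Suc K) \<le> 0\<close>, the
      other one \<open>- eseq l K < 0\<close>; no value is positive, so no generator is an
      ascent.\<close>
    have "zact x (alt K us vs) t \<le> 0"
      using state[OF b t, of K] x(1)[OF t] K(1) eK by (auto simp: mult_nonpos_nonneg)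
    thus "desc (ev (alt K us vs)) t" using zact_pos[OF w x(1) t] by fastforce
  qed
  have lists: "xs \<in> lists S" "ys \<in> lists S" using bipartition_lists[OF bip] by auto
  define w0 where "w0 = ev (alt K xs ys)"
  have w0: "longest w0" "ev (alt K ys xs) = w0"
    using long[OF bip] long[OF bipartition_sym[OF bip]] longest_unique by (auto simp: w0_def)
  define c where "c = ev (xs @ ys)"
  have c: "c \<in> carrier W" using lists by (simp add: c_def)
  \<comment> \<open>The \<open>2 * K\<close> blocks split into two halves. For odd \<open>K\<close>
    the second half starts with \<open>ys\<close>, but its product is the longest element all the
    same.\<close>
  have "c [^] K = ev (alt (K + K) xs ys)" using ev_alt_even[OF lists, of K] by (simp add: c_def mult_2)
  also have "\<dots> = w0 \<otimes> w0"
    unfolding alt_add using lists w0(2) by (simp add: alt_lists w0_def)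
  also have "\<dots> = \<one>" by (rule longest_square[OF w0(1)])
  finally have cK: "c [^] K = \<one>" .
  obtain u where u: "distinct u" "set u = S" "ord (ev u) = h"
    using h by (auto simp: has_coxeter_number_def coxeter_element_def)
  have uc: "ev u \<in> carrier W" using u by (auto intro!: ev_closed simp: in_lists_conv_set)
  have "distinct (xs @ ys)" "set (xs @ ys) = S" using bip by (auto simp: bipartition_def)
  hence pow: "ev u [^] n = \<one> \<longleftrightarrow> c [^] n = \<one>" for n :: nat
    unfolding c_def using coxeter_words_same_order[OF fin u(1,2)] by blast
  have hK: "h dvd K" using pow[of K] cK pow_eq_id[OF uc, of K] u(3) by simp
  have h0: "h > 0" using hK \<open>K \<noteq> 0\<close> by (cases h) auto
  have ch: "c [^] h = \<one>" using pow[of h] u(3) uc by (metis pow_ord_eq_1)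
  \<comment> \<open>A proper divisor \<open>h\<close> would give \<open>2 * h \<le> K\<close>, so
    the word of \<open>2 * h\<close> blocks would be reduced and nonempty, although its product is
    \<open>c [^] h = \<one>\<close>.\<close>
  have "h = K"
  proof (rule ccontr)
    assume "h \<noteq> K"
    obtain q where q: "K = h * q" using hK by blast
    have "q \<noteq> 0" "q \<noteq> 1" using q \<open>K \<noteq> 0\<close> \<open>h \<noteq> K\<close> by auto
    hence "2 \<le> q" by simp
    hence "2 * h \<le> K" using q by (simp add: mult.commute)
    hence "len (ev (alt (2 * h) xs ys)) = h * (length xs + length ys)"
      using reduced[OF bip, of "2 * h"] K(2) by (simp add: length_alt_even)
    moreover have "ev (alt (2 * h) xs ys) = \<one>" using ev_alt_even[OF lists, of h] ch by (simp add: c_def)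
    ultimately show False using h0 len_S by simp
  qed
  thus ?thesis using long[OF bip] long[OF bipartition_sym[OF bip]] h0 by simp
qed

lemma compulsive_orbit_card:
  assumes fin: "finite (carrier W)" and irr: "irreducible_coxeter S m"
    and h: "has_coxeter_number W S h" and f: "compulsive W S f" and w: "w \<in> carrier W"
  shows "card (forward_orbit f w) \<le> h"
proof -
  obtain xs ys where bip: "bipartition xs ys" using ex_bipartition[OF fin] by blast
  note bip' = bipartition_sym[OF bip]
  note * = alternating_longest[OF fin irr h bip]
  have sub: "(f ^^ (h - 1)) w \<in> subs us" if b: "bipartition us vs" "longest (ev (alt h us vs))" for us vs
  proof -
    have l: "us \<in> lists S" "vs \<in> lists S" using bipartition_lists[OF b(1)] by auto
    have "w \<in> subs (alt h us vs)"
      using subs_rle[OF _ subs_mem w rle_longest[OF b(2) w]] alt_lists[OF l] by blast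
    moreover have "h = (h - 1) + 1" using * by simp
    ultimately have "(f ^^ (h - 1)) w \<in> subs (alt 1 us vs)"
      using compulsive_iterate_subs[OF f, of us vs w "h - 1" 1] b(1) by (simp add: bipartition_def)
    thus ?thesis by simp
  qed
  have "(f ^^ (h - 1)) w = \<one>"
  proof (rule parabolic_disjoint)
    show "set xs \<subseteq> S" "set ys \<subseteq> S" "set xs \<inter> set ys = {}" using bip by (auto simp: bipartition_def)
    show "(f ^^ (h - 1)) w \<in> parabolic (set xs)" using sub[OF bip] * subs_parabolic by blast
    show "(f ^^ (h - 1)) w \<in> parabolic (set ys)" using sub[OF bip'] * subs_parabolic by blast
  qed
  moreover have "(f ^^ k) \<one> = \<one>" for k by (induction k) (auto simp: compulsive_one[OF f])
  ultimately have stable: "(f ^^ (k + (h - 1))) w = \<one>" for k by (simp add: funpow_add)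
  \<comment> \<open>The fixed point \<one> is reached by index \<open>h - 1\<close>, so the
    \<open>h\<close> indices below \<open>h\<close> exhaust the orbit.\<close>
  have "forward_orbit f w \<subseteq> (\<lambda>k. (f ^^ k) w) ` {..<h}"
  proof
    fix y assume "y \<in> forward_orbit f w"
    then obtain k where k: "y = (f ^^ k) w" by (auto simp: forward_orbit_def)
    show "y \<in> (\<lambda>k. (f ^^ k) w) ` {..<h}"
    proof (cases "k < h")
      case False
      hence "y = (f ^^ (h - 1)) w" using k stable[of "k - (h - 1)"] stable[of 0] by simp
      thus ?thesis using * by auto
    qed (use k in auto)
  qed
  thus ?thesis using surj_card_le[of "{..<h}"] by auto
qed

end

theorem proposition4p2:
  fixes W :: "('a, 'b) monoid_scheme" and S :: "'a set" and m :: "'a \<Rightarrow> 'a \<Rightarrow> enat"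
    and r :: "'a rel"
  assumes "coxeter_system W S m"
    and "semilattice_congruence W S r"
    and "essential W r"
  shows "compulsive W S (stack_sort W S r) \<and>
    (\<forall>h. finite (carrier W) \<longrightarrow> irreducible_coxeter S m \<longrightarrow> has_coxeter_number W S h \<longrightarrow>
       Max ((\<lambda>w. card (forward_orbit (stack_sort W S r) w)) ` carrier W) \<le> h)"
proof -
  interpret coxeter_system W S m by (rule assms(1))
  have c: "compulsive W S (stack_sort W S r)" by (rule compulsive_stack_sort[OF assms(2,3)])
  moreover have "Max ((\<lambda>w. card (forward_orbit (stack_sort W S r) w)) ` carrier W) \<le> h"
    if "finite (carrier W)" "irreducible_coxeter S m" "has_coxeter_number W S h" for h
    using that compulsive_orbit_card[OF that c] by (intro Max.boundedI) auto
  ultimately show ?thesis by blast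
qed

end
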